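(* Let $\Omega,\Omega^*\subset\mathbb{R}^n$ be open balls in one of the two configurations listed in the context. For any positive density functions $f^+\in C(\overline{\Omega})$ and $f^-\in C(\overline{\Omega^*})$ satisfying the normalized balance condition $\int_\Omega f^+dx=\int_{\Omega^*}f^-dx=1$, there exists a global maximizer for the Kantorovich problem $(\mathcal{P})$, i.e. there exists $u\in\mathscr{A}$ such that $$K[u]=\max_{w\in\mathscr{A}}K[w],\qquad K[w]:=\int_U wf\,dx.$$
   Context: $\mathbb{B}(O,R)$ is the open ball in $\mathbb{R}^n$ with center $O$ and radius $R>0$. Two configurations are considered: (a) $\Omega=\mathbb{B}(O_1,R_1)$, $\Omega^*=\mathbb{B}(O_2,R_2)$ with $\Omega\cap\Omega^*=\emptyset$; (b) $\Omega=\mathbb{B}(O_1,R_1)$, $\Omega^*=\mathbb{B}(O_1,R_2)$ with $R_1\neq R_2$. Put $U:=\Omega\cup\Omega^*$. $f^+$ and $f^-$ are density functions on $\Omega$ and $\Omega^*$ respectively, and $f:=f^+-f^-$ (each density extended by zero outside its ball). The admissible set is $$\mathscr{A}:=\Big\{\phi\in W_0^{1,\infty}(U)\cap C(\overline U)\ \Big|\ \|\nabla\phi\|_{L^\infty}\le 1,\ \phi\text{ radially symmetric},\ \phi=0\text{ on }\overline{\Omega\cap\Omega^*}\Big\},$$ where $W_0^{1,\infty}(U)$ is the usual Sobolev space. In configuration (a), "radially symmetric" means radially symmetric about $O_1$ in $\Omega$ and about $O_2$ in $\Omega^*$; in configuration (b), about $O_1$. *)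

theory Defs
  imports "HOL-Analysis.Analysis" "HOL-Probability.Essential_Supremum"
begin

section \<open>Test functions\<close>

fun Ck_fun :: "nat \<Rightarrow> ('a::euclidean_space \<Rightarrow> real) \<Rightarrow> bool" where
  "Ck_fun 0 f \<longleftrightarrow> continuous_on UNIV f"
| "Ck_fun (Suc k) f \<longleftrightarrow>
     (\<forall>x. f differentiable (at x)) \<and> (\<forall>v. Ck_fun k (\<lambda>x. frechet_derivative f (at x) v))"

text \<open>Elements of \<open>C\<^sub>c\<^sup>\<infinity>(U)\<close> are represented by their extensions by zero to the whole space.\<close>

definition test_fun :: "'a::euclidean_space set \<Rightarrow> ('a \<Rightarrow> real) set" where
  "test_fun U = {\<psi>. (\<forall>k. Ck_fun k \<psi>) \<and> compact (closure {x. \<psi> x \<noteq> 0}) \<and>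
                     closure {x. \<psi> x \<noteq> 0} \<subseteq> U}"

definition grad :: "('a::euclidean_space \<Rightarrow> real) \<Rightarrow> 'a \<Rightarrow> 'a" where
  "grad \<psi> x = (\<Sum>b\<in>Basis. frechet_derivative \<psi> (at x) b *\<^sub>R b)"

section \<open>Sobolev spaces\<close>

text \<open>All functions are defined on the whole space, but only their values on \<open>U\<close> matter.\<close>

definition L1_loc :: "'a::euclidean_space set \<Rightarrow> ('a \<Rightarrow> 'b::euclidean_space) set" where
  "L1_loc U = {f. \<forall>K. compact K \<and> K \<subseteq> U \<longrightarrow> integrable (lebesgue_on K) f}"

text \<open>Membership in \<open>L1_loc\<close> is essential here: the Bochner integral of a
  non-integrable function is \<open>0\<close> by convention.\<close>

definition has_weak_gradient ::
    "'a::euclidean_space set \<Rightarrow> ('a \<Rightarrow> real) \<Rightarrow> ('a \<Rightarrow> 'a) \<Rightarrow> bool" where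
  "has_weak_gradient U \<phi> g \<longleftrightarrow> \<phi> \<in> L1_loc U \<and> g \<in> L1_loc U \<and>
     (\<forall>\<psi>\<in>test_fun U. \<forall>b\<in>Basis.
        (LINT x|lebesgue_on U. \<phi> x * frechet_derivative \<psi> (at x) b) =
        - (LINT x|lebesgue_on U. (g x \<bullet> b) * \<psi> x))"

text \<open>The norm is \<open>\<infinity>\<close> for functions whose pointwise norm is not measurable.\<close>

definition Linf_norm :: "'a::euclidean_space set \<Rightarrow> ('a \<Rightarrow> 'b::euclidean_space) \<Rightarrow> ennreal" where
  "Linf_norm U f = esssup (lebesgue_on U) (\<lambda>x. ennreal (norm (f x)))"

definition Linf :: "'a::euclidean_space set \<Rightarrow> ('a \<Rightarrow> 'b::euclidean_space) set" where
  "Linf U = {f. f \<in> borel_measurable (lebesgue_on U) \<and> Linf_norm U f < \<infinity>}"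

definition W1_inf :: "'a::euclidean_space set \<Rightarrow> ('a \<Rightarrow> real) set" where
  "W1_inf U = {\<phi>. \<phi> \<in> Linf U \<and> (\<exists>g. has_weak_gradient U \<phi> g \<and> g \<in> Linf U)}"

text \<open>\<open>W0_1_1 U\<close> is the closure of the test functions in \<open>W\<^sup>1\<^sup>,\<^sup>1(U)\<close>.\<close>

definition W0_1_1 :: "'a::euclidean_space set \<Rightarrow> ('a \<Rightarrow> real) set" where
  "W0_1_1 U = {\<phi>. integrable (lebesgue_on U) \<phi> \<and>
     (\<exists>g. has_weak_gradient U \<phi> g \<and> integrable (lebesgue_on U) g \<and>
       (\<exists>\<psi>. (\<forall>k. \<psi> k \<in> test_fun U) \<and>
         (\<lambda>k. (LINT x|lebesgue_on U. \<bar>\<phi> x - \<psi> k x\<bar>) +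
              (LINT x|lebesgue_on U. norm (g x - grad (\<psi> k) x))) \<longlonglongrightarrow> 0))}"

text \<open>For bounded \<open>U\<close>, the space \<open>W\<^sub>0\<^sup>1\<^sup>,\<^sup>\<infinity>(U)\<close> is, as usual, the space of functions in
  \<open>W\<^sup>1\<^sup>,\<^sup>\<infinity>(U)\<close> with zero trace, \<open>W\<^sup>1\<^sup>,\<^sup>\<infinity>(U) \<inter> W\<^sub>0\<^sup>1\<^sup>,\<^sup>1(U)\<close>. The closure of the test functions in the
  \<open>W\<^sup>1\<^sup>,\<^sup>\<infinity>\<close>-norm would be a different, smaller space that contains only \<open>C\<^sup>1\<close> functions.\<close>

definition W0_1_inf :: "'a::euclidean_space set \<Rightarrow> ('a \<Rightarrow> real) set" where
  "W0_1_inf U = W1_inf U \<inter> W0_1_1 U"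

section \<open>The Kantorovich problem\<close>

definition radially_symmetric_on :: "'a::euclidean_space \<Rightarrow> 'a set \<Rightarrow> ('a \<Rightarrow> real) \<Rightarrow> bool" where
  "radially_symmetric_on c S \<phi> \<longleftrightarrow>
     (\<forall>x\<in>S. \<forall>y\<in>S. dist c x = dist c y \<longrightarrow> \<phi> x = \<phi> y)"

text \<open>For concentric balls the union is the larger ball, so that the two symmetry
  conditions together amount to radial symmetry about the common centre in the whole union.
  The weak gradient is unique almost everywhere, so the existential quantifier over it is
  harmless.\<close>

definition admissible :: "'a::euclidean_space \<Rightarrow> real \<Rightarrow> 'a \<Rightarrow> real \<Rightarrow> ('a \<Rightarrow> real) set" where
  "admissible O\<^sub>1 R\<^sub>1 O\<^sub>2 R\<^sub>2 =
     (let \<Omega> = ball O\<^sub>1 R\<^sub>1; \<Omega>' = ball O\<^sub>2 R\<^sub>2; U = \<Omega> \<union> \<Omega>'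
      in {\<phi>. \<phi> \<in> W0_1_inf U \<and> continuous_on (closure U) \<phi> \<and>
              (\<exists>g. has_weak_gradient U \<phi> g \<and> Linf_norm U g \<le> 1) \<and>
              radially_symmetric_on O\<^sub>1 \<Omega> \<phi> \<and> radially_symmetric_on O\<^sub>2 \<Omega>' \<phi> \<and>
              (\<forall>x\<in>closure (\<Omega> \<inter> \<Omega>'). \<phi> x = 0)})"

definition zero_ext :: "'a set \<Rightarrow> ('a \<Rightarrow> real) \<Rightarrow> 'a \<Rightarrow> real" where
  "zero_ext S h x = (if x \<in> S then h x else 0)"

definition kantorovich ::
    "'a::euclidean_space set \<Rightarrow> 'a set \<Rightarrow> ('a \<Rightarrow> real) \<Rightarrow> ('a \<Rightarrow> real) \<Rightarrow> ('a \<Rightarrow> real) \<Rightarrow> real" where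
  "kantorovich \<Omega> \<Omega>' f\<^sub>p f\<^sub>m w =
     (LINT x|lebesgue_on (\<Omega> \<union> \<Omega>'). w x * (zero_ext \<Omega> f\<^sub>p x - zero_ext \<Omega>' f\<^sub>m x))"

end

theory Submission
  imports Defs
begin

text \<open>In both configurations the maximiser can be written down. The density \<open>f\<close> has a constant sign on
each part of \<open>U\<close> where an admissible function may be non-zero: it is positive on
\<open>\<Omega> - \<Omega>'\<close> and negative on \<open>\<Omega>' - \<Omega>\<close>, while admissible functions vanish on \<open>\<Omega> \<inter> \<Omega>'\<close>. So it suffices
to find the smallest function that bounds the modulus of every admissible \<open>w\<close>, to give it the sign of
\<open>f\<close>, and to check that the result is itself admissible.

The bound comes from the constraint on the gradient. A function of zero trace whose weak gradient
has norm at most \<open>1\<close> is, after extension by zero, 1-Lipschitz off the boundary of its domain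
(\<open>W0_zero_extension_lipschitz\<close>). For this \<open>w\<close> is averaged against a bump \<open>\<eta>\<close> and
the average is differentiated along a translation of
\<open>\<eta>\<close>: the derivative is the average of the gradient, also when the support of \<open>\<eta>\<close> leaves \<open>U\<close>, because
\<open>w\<close> is an \<open>L\<^sup>1\<close>-limit of test functions together with its gradient
(\<open>W0_1_1_integration_by_parts\<close>). Together with radial symmetry this bounds \<open>\<bar>w x\<bar>\<close> by the distance
of \<open>x\<close> to the boundary sphere of its ball, and, for concentric balls, also by the distance to the inner ball,
where \<open>w\<close> vanishes. The bounds are tent functions of the distance \<open>r\<close> to a centre:
\<open>R - r\<close> on a ball of radius \<open>R\<close>, and \<open>min (r - R) (R' - r)\<close> on the shell \<open>R < r < R'\<close>. Both have the form
\<open>max 0 (a - \<bar>r - m\<bar>)\<close>.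

Admissibility of the tents requires explicit test functions. Replacing the modulus \<open>\<bar>t\<bar>\<close> by
\<open>sqrt (t\<^sup>2 + e\<^sup>2)\<close>, both for \<open>r\<close> and for the outer modulus, and the positive part by
\<open>t * exp (- e / t)\<close> for \<open>t > 0\<close> yields smooth functions with compact support whose gradients have norm
at most \<open>1\<close>. As \<open>e\<close> tends to \<open>0\<close> they and their gradients converge at every point and stay bounded, so
dominated convergence identifies the weak gradient of the limit and gives convergence in
\<open>W\<^sup>1\<^sup>,\<^sup>1\<close> (\<open>W0_1_inf_limit\<close>).\<close>

section \<open>Smooth functions\<close>

definition smooth :: "('a::euclidean_space \<Rightarrow> real) \<Rightarrow> bool" where
  "smooth f \<longleftrightarrow> (\<forall>k. Ck_fun k f)"

lemma Ck_fun_SucI: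
  assumes "\<And>x. (f has_derivative f' x) (at x)" "\<And>v. Ck_fun k (\<lambda>x. f' x v)"
  shows "Ck_fun (Suc k) f"
proof -
  have "frechet_derivative f (at x) = f' x" for x
    using frechet_derivative_at[OF assms(1)] by simp
  then show ?thesis
    using assms by (auto simp: differentiable_def)
qed

lemma Ck_fun_has_derivative:
  "Ck_fun (Suc k) f \<Longrightarrow> (f has_derivative frechet_derivative f (at x)) (at x)"
  by (simp add: frechet_derivative_works)

lemma Ck_fun_SucD: "Ck_fun (Suc k) f \<Longrightarrow> Ck_fun k f"
proof (induction k arbitrary: f)
  case 0
  then show ?case
    using differentiable_imp_continuous_within
    by (force simp: continuous_on_eq_continuous_within)
next
  case (Suc k)
  show ?case
    using Suc.prems Suc.IH[of "\<lambda>x. frechet_derivative f (at x) _"] by auto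
qed

lemma Ck_fun_const: "Ck_fun k (\<lambda>x. c)"
proof (induction k arbitrary: c)
  case (Suc k)
  show ?case
    by (rule Ck_fun_SucI[where f' = "\<lambda>x v. 0"]) (simp_all add: Suc)
qed simp

lemma Ck_fun_add: "Ck_fun k f \<Longrightarrow> Ck_fun k g \<Longrightarrow> Ck_fun k (\<lambda>x. f x + g x)"
proof (induction k arbitrary: f g)
  case 0
  then show ?case by (auto intro: continuous_on_add continuous_on_mult)
next
  case (Suc k)
  show ?case
    by (rule Ck_fun_SucI[OF has_derivative_add[OF Suc.prems[THEN Ck_fun_has_derivative]]])
       (use Suc in auto)
qed

lemma Ck_fun_mult: "Ck_fun k f \<Longrightarrow> Ck_fun k g \<Longrightarrow> Ck_fun k (\<lambda>x. f x * g x)"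
proof (induction k arbitrary: f g)
  case 0
  then show ?case by (auto intro: continuous_on_add continuous_on_mult)
next
  case (Suc k)
  show ?case
    by (rule Ck_fun_SucI[OF has_derivative_mult[OF Suc.prems[THEN Ck_fun_has_derivative]]])
       (rule Ck_fun_add; rule Suc.IH; use Suc.prems Ck_fun_SucD in auto)
qed

lemma smooth_has_derivative:
  "smooth f \<Longrightarrow> (f has_derivative frechet_derivative f (at x)) (at x)"
  using Ck_fun_has_derivative unfolding smooth_def by blast

lemma smooth_continuous_on: "smooth f \<Longrightarrow> continuous_on S f"
  using continuous_on_subset unfolding smooth_def by (metis Ck_fun.simps(1) subset_UNIV)

lemma smooth_frechet_derivative: "smooth f \<Longrightarrow> smooth (\<lambda>x. frechet_derivative f (at x) v)"
  unfolding smooth_def by (metis Ck_fun.simps(2))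

lemma smoothI_derivative:
  assumes "\<And>x. (f has_derivative f' x) (at x)" "\<And>v. smooth (\<lambda>x. f' x v)"
  shows "smooth f"
  unfolding smooth_def
proof
  fix k
  have "Ck_fun (Suc k) f"
    using assms by (intro Ck_fun_SucI) (auto simp: smooth_def)
  then show "Ck_fun k f"
    by (rule Ck_fun_SucD)
qed

lemma smooth_const [intro]: "smooth (\<lambda>x. c)"
  by (simp add: smooth_def Ck_fun_const)

lemma smooth_add [intro]: "smooth f \<Longrightarrow> smooth g \<Longrightarrow> smooth (\<lambda>x. f x + g x)"
  by (simp add: smooth_def Ck_fun_add)

lemma smooth_mult [intro]: "smooth f \<Longrightarrow> smooth g \<Longrightarrow> smooth (\<lambda>x. f x * g x)"
  by (simp add: smooth_def Ck_fun_mult)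

lemma smooth_diff [intro]: "smooth f \<Longrightarrow> smooth g \<Longrightarrow> smooth (\<lambda>x. f x - g x)"
  using smooth_add[OF _ smooth_mult[OF smooth_const[of "-1"]], of f g] by simp

lemma smooth_linear: "bounded_linear f \<Longrightarrow> smooth f"
  using smoothI_derivative[of f "\<lambda>x. f"] bounded_linear.has_derivative[OF _ has_derivative_ident]
  by auto

lemma smooth_norm_power2 [intro]: "smooth (\<lambda>x. (norm (x - c))\<^sup>2)"
proof (rule smoothI_derivative)
  show "((\<lambda>x. (norm (x - c))\<^sup>2) has_derivative (\<lambda>v. 2 * (x \<bullet> v - c \<bullet> v))) (at x)" for x
    unfolding power2_norm_eq_inner
    by (auto intro!: derivative_eq_intros simp: inner_diff_left algebra_simps inner_commute)
  show "smooth (\<lambda>x. 2 * (x \<bullet> v - c \<bullet> v))" for v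
    by (intro smooth_mult smooth_diff smooth_const smooth_linear bounded_linear_inner_left)
qed

lemma has_derivative_translate:
  assumes "(f has_derivative f') (at (x - c))"
  shows "((\<lambda>x. f (x - c)) has_derivative f') (at (x::'a::real_normed_vector))"
  by (rule has_derivative_compose[OF has_derivative_diff[OF has_derivative_ident has_derivative_const],
        of f f' x c, simplified, OF assms])

lemma Ck_fun_translate: "Ck_fun k f \<Longrightarrow> Ck_fun k (\<lambda>x. f (x - c))"
proof (induction k arbitrary: f)
  case 0
  then show ?case
    using continuous_on_compose2[of UNIV f UNIV "\<lambda>x. x - c"] by (simp add: continuous_on_diff)
next
  case (Suc k)
  show ?case
    by (rule Ck_fun_SucI[OF has_derivative_translate[OF Ck_fun_has_derivative[OF Suc.prems]]],
        rule Suc.IH) (use Suc.prems in simp)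
qed

text \<open>The derivative of \<open>F \<circ> f\<close> contains \<open>F' \<circ> f\<close>, so the induction runs over all smooth outer functions
simultaneously, with \<open>f\<close> fixed.\<close>

lemma smooth_compose:
  fixes F :: "real \<Rightarrow> real"
  assumes "smooth F" "smooth f"
  shows "smooth (\<lambda>x. F (f x))"
proof -
  have "Ck_fun k (\<lambda>x. F (f x))" if "smooth F" for k and F :: "real \<Rightarrow> real"
    using that
  proof (induction k arbitrary: F)
    case 0
    show ?case
      using continuous_on_compose2[OF smooth_continuous_on[OF 0, of UNIV]
          smooth_continuous_on[OF assms(2), of UNIV]] by simp
  next
    case (Suc k)
    have "((\<lambda>x. F (f x)) has_derivative
        (\<lambda>v. frechet_derivative f (at x) v * frechet_derivative F (at (f x)) 1)) (at x)" for x
    proof -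
      have *: "frechet_derivative F (at (f x)) w = w * frechet_derivative F (at (f x)) 1" for w
        using linear_cmul[OF has_derivative_linear[OF smooth_has_derivative[OF Suc.prems]], of "f x" w 1]
        by simp
      show ?thesis
        using has_derivative_compose[OF smooth_has_derivative[OF assms(2)]
            smooth_has_derivative[OF Suc.prems], of x]
        by (subst (asm) *)
    qed
    then show ?case
    proof (rule Ck_fun_SucI)
      fix v
      show "Ck_fun k (\<lambda>x. frechet_derivative f (at x) v * frechet_derivative F (at (f x)) 1)"
        using smooth_frechet_derivative[OF assms(2), of v] Suc.IH[OF smooth_frechet_derivative[OF Suc.prems]]
        by (auto intro!: Ck_fun_mult simp: smooth_def)
    qed
  qed
  then show ?thesis
    using assms(1) by (auto simp: smooth_def)
qed

text \<open>Differentiation lowers the exponent by one, so the induction on the order of differentiability has to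
treat all exponents at once.\<close>

lemma smooth_powr:
  assumes "smooth f" "\<And>x. f x > 0"
  shows "smooth (\<lambda>x. f x powr a)"
proof -
  have "Ck_fun k (\<lambda>x. f x powr a)" for k a
  proof (induction k arbitrary: a)
    case 0
    have "\<forall>x. f x \<noteq> 0"
      using assms(2) by (metis less_irrefl)
    then show ?case
      using smooth_continuous_on[OF assms(1)] by (auto intro!: continuous_on_powr)
  next
    case (Suc k)
    show ?case
    proof (rule Ck_fun_SucI)
      show "((\<lambda>x. f x powr a) has_derivative
          (\<lambda>v. a * f x powr (a - 1) * frechet_derivative f (at x) v)) (at x)" for x
        using has_derivative_compose[OF smooth_has_derivative[OF assms(1), of x]
            has_real_derivative_powr[OF assms(2), of a x, unfolded has_field_derivative_def]]
        by simp
      show "Ck_fun k (\<lambda>x. a * f x powr (a - 1) * frechet_derivative f (at x) v)" for v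
        using Suc smooth_frechet_derivative[OF assms(1), of v]
        by (auto intro!: Ck_fun_mult Ck_fun_const simp: smooth_def)
    qed
  qed
  then show ?thesis by (simp add: smooth_def)
qed

lemma smooth_sqrt:
  assumes "smooth f" "\<And>x. f x > 0"
  shows "smooth (\<lambda>x. sqrt (f x))"
  using smooth_powr[OF assms, of "1/2"] assms(2) by (simp add: powr_half_sqrt less_imp_le)

text \<open>The smooth function \<open>exp (- 1 / t)\<close>, continued by \<open>0\<close> for \<open>t \<le> 0\<close>, is \<open>flat_exp 0\<close>. Its derivatives
are polynomials in \<open>1 / t\<close> times the function itself; the family over all powers \<open>j\<close> is closed under
differentiation up to linear combinations, so that smoothness follows by induction.\<close>

definition flat_exp :: "nat \<Rightarrow> real \<Rightarrow> real" where
  "flat_exp j t = (if t > 0 then exp (- 1 / t) / t ^ j else 0)"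

text \<open>The exponential beats every power of \<open>t\<close>. A quadratic bound is what yields the derivative \<open>0\<close> at the
origin.\<close>

lemma flat_exp_bound: "\<exists>C. \<forall>t. \<bar>flat_exp j t\<bar> \<le> C * t\<^sup>2"
proof (intro exI allI)
  fix t :: real
  define n where "n = j + 2"
  have n: "n > 0" "t ^ n = t ^ j * t\<^sup>2"
    by (simp_all add: n_def power_add power2_eq_square)
  show "\<bar>flat_exp j t\<bar> \<le> n ^ n * t\<^sup>2"
  proof (cases "t > 0")
    case True
    \<comment> \<open>The crude estimate \<open>(s / n) ^ n \<le> exp s\<close> at \<open>s = 1 / t\<close> suffices.\<close>
    have "(1 / (t * n)) ^ n \<le> (1 + 1 / t / n) ^ n"
      using True n by (intro power_mono) auto
    also have "\<dots> \<le> exp (1 / t)"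
      using True n by (intro exp_ge_one_plus_x_over_n_power_n) (auto intro: order_trans[of _ 0])
    finally have "1 / (t ^ n * n ^ n) \<le> exp (1 / t)"
      by (simp add: power_divide power_mult_distrib)
    then have "exp (- 1 / t) \<le> n ^ n * t ^ n"
      using True n(1) by (simp add: exp_minus field_simps)
    also have "n ^ n * t ^ n = n ^ n * t\<^sup>2 * t ^ j"
      by (simp only: n(2) mult_ac)
    finally have "exp (- 1 / t) / t ^ j \<le> n ^ n * t\<^sup>2"
      using True by (simp only: pos_divide_le_eq zero_less_power)
    then show ?thesis
      using True by (simp add: flat_exp_def)
  qed (simp add: flat_exp_def)
qed

lemma flat_exp_has_derivative:
  "(flat_exp j has_derivative (\<lambda>v. (flat_exp (j + 2) t - j * flat_exp (j + 1) t) * v)) (at t)"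
proof -
  consider "t > 0" | "t < 0" | "t = 0" by linarith
  then have "(flat_exp j has_real_derivative flat_exp (j + 2) t - j * flat_exp (j + 1) t) (at t)"
  proof cases
    case 1
    have "((\<lambda>t. exp (- 1 / t) / t ^ j) has_real_derivative
        flat_exp (j + 2) t - j * flat_exp (j + 1) t) (at t)"
    proof -
      have inv: "(inverse has_real_derivative - (inverse t ^ 2)) (at t)"
        using DERIV_inverse[of t] 1 by (simp add: numeral_2_eq_2)
      have "((\<lambda>t. exp (- inverse t)) has_real_derivative exp (- inverse t) * inverse t ^ 2) (at t)"
        using DERIV_fun_exp[OF DERIV_minus[OF inv]] by simp
      from DERIV_mult[OF this DERIV_power[OF inv, of j]]
      have "((\<lambda>t. exp (- 1 / t) * inverse t ^ j) has_real_derivative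
          exp (- 1 / t) * inverse t ^ 2 * inverse t ^ j
          + exp (- 1 / t) * (j * inverse t ^ (j - 1) * (- (inverse t ^ 2)))) (at t)"
        by (simp add: divide_inverse mult_ac)
      moreover have "exp (- 1 / t) * inverse t ^ 2 * inverse t ^ j
          + exp (- 1 / t) * (j * inverse t ^ (j - 1) * (- (inverse t ^ 2)))
          = flat_exp (j + 2) t - j * flat_exp (j + 1) t"
        using 1 by (cases j) (simp_all add: flat_exp_def divide_inverse power2_eq_square power_inverse)
      ultimately show ?thesis
        by (simp add: divide_inverse power_inverse)
    qed
    then show ?thesis
      by (rule has_field_derivative_transform_within_open[OF _ open_greaterThan[of 0]])
        (use 1 in \<open>auto simp: flat_exp_def\<close>)
  next
    case 2
    have "((\<lambda>t. 0) has_real_derivative flat_exp (j + 2) t - j * flat_exp (j + 1) t) (at t)"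
      using 2 by (auto simp: flat_exp_def)
    then show ?thesis
      by (rule has_field_derivative_transform_within_open[OF _ open_lessThan[of 0]])
        (use 2 in \<open>auto simp: flat_exp_def\<close>)
  next
    case 3
    obtain C where C: "\<And>t. \<bar>flat_exp j t\<bar> \<le> C * t\<^sup>2"
      using flat_exp_bound by blast
    have "((\<lambda>h. (flat_exp j (0 + h) - flat_exp j 0) / h) \<longlongrightarrow> 0) (at 0)"
    proof (rule Lim_null_comparison)
      have "\<bar>flat_exp j h / h\<bar> \<le> C * \<bar>h\<bar>" if "h \<noteq> 0" for h
      proof -
        have "\<bar>flat_exp j h\<bar> \<le> C * \<bar>h\<bar> * \<bar>h\<bar>"
          using C[of h] by (simp add: power2_eq_square mult.assoc)
        then show ?thesis
          using that by (simp add: abs_divide pos_divide_le_eq)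
      qed
      then show "\<forall>\<^sub>F h in at 0. norm ((flat_exp j (0 + h) - flat_exp j 0) / h) \<le> C * \<bar>h\<bar>"
        by (auto simp: eventually_at_filter flat_exp_def)
      show "((\<lambda>h. C * \<bar>h\<bar>) \<longlongrightarrow> 0) (at 0)"
        by (auto intro!: tendsto_eq_intros)
    qed
    then show ?thesis
      using 3 by (simp add: DERIV_def flat_exp_def)
  qed
  then show ?thesis
    by (simp only: has_field_derivative_def)
qed

lemma smooth_flat_exp: "smooth (flat_exp j)"
proof -
  have "Ck_fun k (flat_exp j)" for k j
  proof (induction k arbitrary: j)
    case 0
    show ?case
      using has_derivative_continuous[OF flat_exp_has_derivative]
      by (auto simp: continuous_on_eq_continuous_within)
  next
    case (Suc k)
    have "Ck_fun k (\<lambda>t. (flat_exp (j + 2) t + (- real j) * flat_exp (j + 1) t) * v)" for v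
      by (intro Ck_fun_mult[of k _ "\<lambda>_. v"] Ck_fun_mult[of k "\<lambda>_. - real j"] Ck_fun_add
          Ck_fun_const Suc)
    then show ?case
      by (intro Ck_fun_SucI[OF flat_exp_has_derivative]) simp
  qed
  then show ?thesis by (simp add: smooth_def)
qed

section \<open>Test functions\<close>

abbreviation dd :: "('a::euclidean_space \<Rightarrow> real) \<Rightarrow> 'a \<Rightarrow> 'a \<Rightarrow> real" where
  "dd \<psi> v x \<equiv> frechet_derivative \<psi> (at x) v"

lemma dd_eq: "(f has_derivative f') (at x) \<Longrightarrow> dd f v x = f' v"
  by (metis frechet_derivative_at)

lemma test_funI:
  assumes "smooth \<psi>" "compact K" "K \<subseteq> U" "\<And>x. x \<notin> K \<Longrightarrow> \<psi> x = 0"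
  shows "\<psi> \<in> test_fun U"
proof -
  have "closure {x. \<psi> x \<noteq> 0} \<subseteq> K"
    using assms by (intro closure_minimal compact_imp_closed) auto
  then have "compact (closure {x. \<psi> x \<noteq> 0})" "closure {x. \<psi> x \<noteq> 0} \<subseteq> U"
    using assms(2,3) closed_Int_compact[OF closed_closure assms(2), of "{x. \<psi> x \<noteq> 0}"]
    by (simp_all add: Int_absorb2)
  then show ?thesis
    using assms(1) by (simp add: test_fun_def smooth_def)
qed

lemma test_fun_smooth: "\<psi> \<in> test_fun U \<Longrightarrow> smooth \<psi>"
  by (auto simp: test_fun_def smooth_def)

lemma test_fun_support:
  assumes "\<psi> \<in> test_fun U"
  obtains K where "compact K" "K \<subseteq> U" "\<And>x. x \<notin> K \<Longrightarrow> \<psi> x = 0"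
    "\<And>x v. x \<notin> K \<Longrightarrow> dd \<psi> v x = 0"
proof
  let ?K = "closure {x. \<psi> x \<noteq> 0}"
  show "compact ?K" "?K \<subseteq> U"
    using assms by (auto simp: test_fun_def)
  show zero: "\<psi> x = 0" if "x \<notin> ?K" for x
    using that subsetD[OF closure_subset, of x "{x. \<psi> x \<noteq> 0}"] by auto
  show "dd \<psi> v x = 0" if "x \<notin> ?K" for x v
  proof (rule dd_eq)
    show "(\<psi> has_derivative (\<lambda>v. 0)) (at x)"
    proof (rule has_derivative_transform_within_open[OF has_derivative_const[of 0]])
      show "open (- ?K)"
        by (rule open_Compl[OF closed_closure])
      show "x \<in> - ?K"
        using that by simp
      show "0 = \<psi> y" if "y \<in> - ?K" for y
        using zero[of y] that by simp
    qed
  qed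
qed

lemma test_fun_zero:
  assumes "\<psi> \<in> test_fun U" "x \<notin> U"
  shows "\<psi> x = 0" "dd \<psi> v x = 0"
proof -
  obtain K where "compact K" "K \<subseteq> U" "\<And>x. x \<notin> K \<Longrightarrow> \<psi> x = 0"
    "\<And>x v. x \<notin> K \<Longrightarrow> dd \<psi> v x = 0"
    by (rule test_fun_support[OF assms(1)], rule that)
  with assms(2) show "\<psi> x = 0" "dd \<psi> v x = 0"
    by blast+
qed

lemma test_fun_mono: "\<psi> \<in> test_fun U \<Longrightarrow> U \<subseteq> V \<Longrightarrow> \<psi> \<in> test_fun V"
  by (auto simp: test_fun_def)

lemma test_fun_mult:
  assumes "\<psi> \<in> test_fun U" "smooth \<phi>"
  shows "(\<lambda>x. \<psi> x * \<phi> x) \<in> test_fun U"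
proof -
  obtain K where "compact K" "K \<subseteq> U" "\<And>x. x \<notin> K \<Longrightarrow> \<psi> x = 0"
    "\<And>x v. x \<notin> K \<Longrightarrow> dd \<psi> v x = 0"
    by (rule test_fun_support[OF assms(1)], rule that)
  then show ?thesis
    using test_fun_smooth[OF assms(1)] assms(2) by (intro test_funI[of _ K]) auto
qed

lemma test_fun_add:
  assumes "\<psi> \<in> test_fun U" "\<phi> \<in> test_fun U"
  shows "(\<lambda>x. \<psi> x + \<phi> x) \<in> test_fun U"
proof -
  obtain K where "compact K" "K \<subseteq> U" "\<And>x. x \<notin> K \<Longrightarrow> \<psi> x = 0"
    "\<And>x v. x \<notin> K \<Longrightarrow> dd \<psi> v x = 0"
    by (rule test_fun_support[OF assms(1)], rule that)
  moreover obtain L where "compact L" "L \<subseteq> U" "\<And>x. x \<notin> L \<Longrightarrow> \<phi> x = 0"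
    "\<And>x v. x \<notin> L \<Longrightarrow> dd \<phi> v x = 0"
    by (rule test_fun_support[OF assms(2)], rule that)
  ultimately show ?thesis
    using assms[THEN test_fun_smooth] by (intro test_funI[of _ "K \<union> L"]) auto
qed

lemma dd_test_fun:
  assumes "\<psi> \<in> test_fun U"
  shows "dd \<psi> v \<in> test_fun U"
proof -
  obtain K where "compact K" "K \<subseteq> U" "\<And>x. x \<notin> K \<Longrightarrow> \<psi> x = 0"
    "\<And>x v. x \<notin> K \<Longrightarrow> dd \<psi> v x = 0"
    by (rule test_fun_support[OF assms], rule that)
  then show ?thesis
    using smooth_frechet_derivative[OF test_fun_smooth[OF assms]] by (intro test_funI[of _ K]) auto
qed

lemma dd_mult:
  assumes "smooth \<psi>" "smooth \<phi>"
  shows "dd (\<lambda>x. \<psi> x * \<phi> x) v x = \<psi> x * dd \<phi> v x + dd \<psi> v x * \<phi> x"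
  by (rule dd_eq[OF has_derivative_mult[OF assms[THEN smooth_has_derivative]]])

lemma dd_basis:
  assumes "smooth \<psi>"
  shows "dd \<psi> v x = (\<Sum>b\<in>Basis. (v \<bullet> b) * dd \<psi> b x)"
proof -
  interpret linear "frechet_derivative \<psi> (at x)"
    by (rule has_derivative_linear[OF smooth_has_derivative[OF assms]])
  show ?thesis
    by (subst euclidean_representation[of v, symmetric]) (simp only: sum scale, simp)
qed

lemma dd_eq_grad: "smooth \<psi> \<Longrightarrow> dd \<psi> v x = v \<bullet> grad \<psi> x"
  by (subst dd_basis) (auto simp: grad_def inner_sum_right mult.commute)

lemma grad_eq:
  assumes "(f has_derivative (\<lambda>v. G \<bullet> v)) (at x)"
  shows "grad f x = G"
  unfolding grad_def dd_eq[OF assms] by (rule euclidean_representation)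

lemma test_fun_cmult: "\<psi> \<in> test_fun U \<Longrightarrow> (\<lambda>x. s * \<psi> x) \<in> test_fun U"
  using test_fun_mult[OF _ smooth_const, of \<psi> U s] by (simp add: mult.commute)

lemma has_derivative_grad:
  assumes "smooth \<psi>"
  shows "(\<psi> has_derivative (\<lambda>v. grad \<psi> x \<bullet> v)) (at x)"
proof -
  have "frechet_derivative \<psi> (at x) = (\<lambda>v. grad \<psi> x \<bullet> v)"
    by (simp add: fun_eq_iff dd_eq_grad[OF assms] inner_commute)
  then show ?thesis
    using smooth_has_derivative[OF assms, of x] by simp
qed

lemma grad_cmult: "smooth \<psi> \<Longrightarrow> grad (\<lambda>x. s * \<psi> x) x = s *\<^sub>R grad \<psi> x"
  by (rule grad_eq) (auto intro!: derivative_eq_intros has_derivative_grad)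

lemma grad_diff: "smooth \<psi> \<Longrightarrow> smooth \<phi> \<Longrightarrow> grad (\<lambda>x. \<psi> x - \<phi> x) x = grad \<psi> x - grad \<phi> x"
  by (rule grad_eq) (auto intro!: derivative_eq_intros has_derivative_grad simp: inner_diff_left)

lemma grad_test_fun_zero: "\<psi> \<in> test_fun U \<Longrightarrow> x \<notin> U \<Longrightarrow> grad \<psi> x = 0"
  by (simp add: grad_def test_fun_zero)

lemma dd_translate: "smooth f \<Longrightarrow> dd (\<lambda>x. f (x - c)) v x = dd f v (x - c)"
  by (rule dd_eq[OF has_derivative_translate[OF smooth_has_derivative]])

lemma test_fun_translate:
  assumes "\<eta> \<in> test_fun UNIV"
  shows "(\<lambda>x. \<eta> (x - c)) \<in> test_fun UNIV"
proof -
  obtain K where K: "compact K" "K \<subseteq> UNIV" "\<And>x. x \<notin> K \<Longrightarrow> \<eta> x = 0"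
    "\<And>x v. x \<notin> K \<Longrightarrow> dd \<eta> v x = 0"
    by (rule test_fun_support[OF assms], rule that)
  show ?thesis
  proof (rule test_funI)
    show "smooth (\<lambda>x. \<eta> (x - c))"
      using test_fun_smooth[OF assms] by (simp add: smooth_def Ck_fun_translate)
    show "compact ((+) c ` K)"
      by (rule compact_translation[OF K(1)])
    show "\<eta> (x - c) = 0" if "x \<notin> (+) c ` K" for x
    proof (rule K(3), rule notI)
      assume "x - c \<in> K"
      then have "c + (x - c) \<in> (+) c ` K"
        by (rule imageI)
      with that show False by simp
    qed
  qed simp
qed

lemma test_fun_bounded:
  assumes "\<psi> \<in> test_fun U"
  obtains C where "C \<ge> 0" "\<And>x. \<bar>\<psi> x\<bar> \<le> C"
proof -
  obtain K where K: "compact K" "K \<subseteq> U" "\<And>x. x \<notin> K \<Longrightarrow> \<psi> x = 0"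
    "\<And>x v. x \<notin> K \<Longrightarrow> dd \<psi> v x = 0"
    by (rule test_fun_support[OF assms], rule that)
  have "bounded (\<psi> ` K)"
    using K smooth_continuous_on[OF test_fun_smooth[OF assms]]
    by (intro compact_imp_bounded compact_continuous_image)
  then obtain C where "C > 0" and C: "\<And>x. x \<in> K \<Longrightarrow> \<bar>\<psi> x\<bar> \<le> C"
    by (auto simp: bounded_pos)
  show thesis
  proof
    show "C \<ge> 0"
      using \<open>C > 0\<close> by simp
    show "\<bar>\<psi> x\<bar> \<le> C" for x
      using C K(3)[of x] \<open>C > 0\<close> by (cases "x \<in> K") auto
  qed
qed

lemma test_fun_dd_bounded:
  assumes "\<psi> \<in> test_fun U"
  obtains C where "C \<ge> 0" "\<And>v x. \<bar>dd \<psi> v x\<bar> \<le> C * norm v"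
proof -
  have "\<forall>b. \<exists>C. C \<ge> 0 \<and> (\<forall>x. \<bar>dd \<psi> b x\<bar> \<le> C)"
    using test_fun_bounded[OF dd_test_fun[OF assms]] by metis
  then obtain C where C: "\<And>b. C b \<ge> 0" "\<And>b x. \<bar>dd \<psi> b x\<bar> \<le> C b"
    by metis
  have "\<bar>dd \<psi> v x\<bar> \<le> (\<Sum>b\<in>Basis. C b) * norm v" for v x
  proof -
    have "\<bar>dd \<psi> v x\<bar> \<le> (\<Sum>b\<in>Basis. \<bar>(v \<bullet> b) * dd \<psi> b x\<bar>)"
      by (subst dd_basis[OF test_fun_smooth[OF assms]]) (rule sum_abs)
    also have "\<dots> \<le> (\<Sum>b\<in>Basis. norm v * C b)"
      by (intro sum_mono) (auto simp: abs_mult intro!: mult_mono C Basis_le_norm)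
    finally show ?thesis
      by (simp add: sum_distrib_left mult.commute)
  qed
  with C(1) show thesis
    using that[of "\<Sum>b\<in>Basis. C b"] by (simp add: sum_nonneg)
qed

lemma test_fun_lipschitz:
  assumes "\<psi> \<in> test_fun U"
  obtains C where "C \<ge> 0" "\<And>x y. \<bar>\<psi> x - \<psi> y\<bar> \<le> C * norm (x - y)"
proof -
  obtain C where C: "C \<ge> 0" "\<And>v x. \<bar>dd \<psi> v x\<bar> \<le> C * norm v"
    using test_fun_dd_bounded[OF assms] by metis
  have "norm (\<psi> x - \<psi> y) \<le> C * norm (x - y)" for x y
  proof (rule differentiable_bound[of UNIV])
    show "onorm (\<lambda>v. dd \<psi> v x) \<le> C" for x
      using C by (intro onorm_le) auto
    show "(\<psi> has_derivative (\<lambda>v. dd \<psi> v x)) (at x within UNIV)" for x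
      using smooth_has_derivative[OF test_fun_smooth[OF assms]] by simp
  qed auto
  with C that show thesis by auto
qed

lemma test_fun_borel_measurable: "\<psi> \<in> test_fun U \<Longrightarrow> \<psi> \<in> borel_measurable borel"
  by (intro borel_measurable_continuous_onI smooth_continuous_on test_fun_smooth)

lemma borel_measurable_lebesgue_on:
  fixes f :: "'a::euclidean_space \<Rightarrow> 'b::topological_space"
  assumes "f \<in> borel_measurable borel"
  shows "f \<in> borel_measurable (lebesgue_on S)"
proof -
  have "f \<in> borel_measurable lborel"
    using assms by simp
  then show ?thesis
    by (intro measurable_restrict_space1 measurable_completion)
qed

lemma test_fun_integrable:
  assumes "\<psi> \<in> test_fun U" "S \<in> sets lebesgue"
  shows "integrable (lebesgue_on S) \<psi>"
proof -
  obtain K where K: "compact K" "K \<subseteq> U" "\<And>x. x \<notin> K \<Longrightarrow> \<psi> x = 0"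
    "\<And>x v. x \<notin> K \<Longrightarrow> dd \<psi> v x = 0"
    by (rule test_fun_support[OF assms(1)], rule that)
  have "integrable lborel (\<lambda>x. indicator K x *\<^sub>R \<psi> x)"
    using K smooth_continuous_on[OF test_fun_smooth[OF assms(1)]]
    by (intro borel_integrable_compact)
  also have "(\<lambda>x. indicator K x *\<^sub>R \<psi> x) = \<psi>"
    using K by (auto simp: indicator_def fun_eq_iff)
  finally have "integrable lebesgue \<psi>"
    using test_fun_borel_measurable[OF assms(1)] by (subst integrable_completion) auto
  then show ?thesis
    using integrable_mult_indicator[OF assms(2), of \<psi>] assms(2)
    by (subst integrable_restrict_space) simp_all
qed

lemma test_fun_measurable:
  "\<psi> \<in> test_fun U \<Longrightarrow> \<psi> \<in> borel_measurable (lebesgue_on S)"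
  by (intro borel_measurable_lebesgue_on test_fun_borel_measurable)

lemma grad_test_fun_integrable:
  assumes "\<psi> \<in> test_fun U" "S \<in> sets lebesgue"
  shows "integrable (lebesgue_on S) (grad \<psi>)"
proof -
  have "integrable (lebesgue_on S) (\<lambda>x. \<Sum>b\<in>Basis. dd \<psi> b x *\<^sub>R b)"
    using test_fun_integrable[OF dd_test_fun[OF assms(1)] assms(2)]
    by (intro Bochner_Integration.integrable_sum integrable_scaleR_left) auto
  then show ?thesis
    by (simp add: grad_def[abs_def])
qed

section \<open>Integration by parts\<close>

lemma integral_lebesgue_on_superset:
  fixes f :: "'a::euclidean_space \<Rightarrow> 'b::euclidean_space"
  assumes "S \<in> sets lebesgue" "\<And>x. x \<notin> S \<Longrightarrow> f x = 0"
  shows "(LINT x|lebesgue_on S. f x) = (LINT x|lebesgue. f x)"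
proof -
  have "(\<lambda>x. if x \<in> S then f x else 0) = f"
    using assms(2) by auto
  then show ?thesis
    using Lebesgue_Measure.integral_restrict_UNIV[OF assms(1), of f] by simp
qed

lemma integral_translation:
  fixes f :: "'a::euclidean_space \<Rightarrow> real"
  assumes "f \<in> borel_measurable borel"
  shows "(LINT x|lebesgue. f (x - a)) = (LINT x|lebesgue. f x)"
proof -
  have "(LINT x|lborel. f (x - a)) = (LINT x|distr lborel borel ((+) (-a)). f x)"
    using assms by (subst integral_distr) (auto simp: add.commute)
  also have "\<dots> = (LINT x|lborel. f x)"
    by (simp add: lborel_distr_plus)
  moreover have "(\<lambda>x. f (x - a)) \<in> borel_measurable borel"
    by (rule measurable_compose[OF _ assms]) measurable
  ultimately show ?thesis
    using assms by (simp add: integral_completion)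
qed

text \<open>Differentiation under the integral sign. With \<open>w = 1\<close> on a large ball the integral is
constant for small \<open>t\<close>, which gives integration by parts; with \<open>w\<close> an admissible function the formula gives
the Lipschitz estimate.\<close>

lemma DERIV_translated_integral:
  fixes \<eta> :: "'a::euclidean_space \<Rightarrow> real"
  assumes S: "S \<in> sets lebesgue" and w: "integrable (lebesgue_on S) w" and \<eta>: "\<eta> \<in> test_fun UNIV"
  shows "((\<lambda>t. LINT x|lebesgue_on S. w x * \<eta> (x - t *\<^sub>R v)) has_real_derivative
      - (LINT x|lebesgue_on S. w x * dd \<eta> v (x - t *\<^sub>R v))) (at t)"
proof -
  obtain B where B: "\<And>x. \<bar>\<eta> x\<bar> \<le> B"
    using test_fun_bounded[OF \<eta>] by metis
  obtain C where C: "C \<ge> 0" "\<And>x y. \<bar>\<eta> x - \<eta> y\<bar> \<le> C * norm (x - y)"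
    using test_fun_lipschitz[OF \<eta>] by metis
  have [measurable]: "(\<lambda>x. \<eta> (x - a)) \<in> borel_measurable (lebesgue_on S)" for a
    by (intro borel_measurable_lebesgue_on measurable_compose[OF _ test_fun_borel_measurable[OF \<eta>]])
      measurable
  have [measurable]: "(\<lambda>x. dd \<eta> v (x - a)) \<in> borel_measurable (lebesgue_on S)" for a
    by (intro borel_measurable_lebesgue_on
        measurable_compose[OF _ test_fun_borel_measurable[OF dd_test_fun[OF \<eta>]]]) measurable
  have [measurable]: "w \<in> borel_measurable (lebesgue_on S)"
    using w by auto
  have int: "integrable (lebesgue_on S) (\<lambda>x. w x * \<eta> (x - a))" for a
  proof (rule Bochner_Integration.integrable_bound)
    show "integrable (lebesgue_on S) (\<lambda>x. B * w x)"
      using w by simp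
    show "AE x in lebesgue_on S. norm (w x * \<eta> (x - a)) \<le> norm (B * w x)"
    proof (intro AE_I2)
      fix x
      have "\<bar>\<eta> (x - a)\<bar> * \<bar>w x\<bar> \<le> \<bar>B\<bar> * \<bar>w x\<bar>"
        using B[of "x - a"] by (intro mult_right_mono) auto
      then show "norm (w x * \<eta> (x - a)) \<le> norm (B * w x)"
        by (simp add: abs_mult mult.commute)
    qed
  qed measurable
  have pointwise: "((\<lambda>h. (\<eta> (x - (t + h) *\<^sub>R v) - \<eta> (x - t *\<^sub>R v)) / h) \<longlongrightarrow> - dd \<eta> v (x - t *\<^sub>R v)) (at 0)"
    for x
  proof -
    have "((\<lambda>t. x - t *\<^sub>R v) has_derivative (\<lambda>h. - (h *\<^sub>R v))) (at t)"
      by (auto intro!: derivative_eq_intros)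
    from has_derivative_compose[OF this smooth_has_derivative[OF test_fun_smooth[OF \<eta>]]]
    have "((\<lambda>t. \<eta> (x - t *\<^sub>R v)) has_derivative (\<lambda>h. dd \<eta> (- (h *\<^sub>R v)) (x - t *\<^sub>R v))) (at t)" .
    moreover have "dd \<eta> (- (h *\<^sub>R v)) y = - dd \<eta> v y * h" for h y
      by (simp add: dd_eq_grad[OF test_fun_smooth[OF \<eta>]])
    ultimately have "((\<lambda>t. \<eta> (x - t *\<^sub>R v)) has_real_derivative - dd \<eta> v (x - t *\<^sub>R v)) (at t)"
      by (simp only: has_field_derivative_def)
    then show ?thesis
      by (simp add: DERIV_def)
  qed
  have "((\<lambda>h. ((LINT x|lebesgue_on S. w x * \<eta> (x - (t + h) *\<^sub>R v))
      - (LINT x|lebesgue_on S. w x * \<eta> (x - t *\<^sub>R v))) / h)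
      \<longlongrightarrow> (LINT x|lebesgue_on S. w x * - dd \<eta> v (x - t *\<^sub>R v))) (at 0)"
    unfolding tendsto_at_iff_sequentially comp_def
  proof (intro allI impI)
    fix s :: "nat \<Rightarrow> real"
    assume s0: "\<forall>i. s i \<in> UNIV - {0}" and s: "s \<longlonglongrightarrow> 0"
    let ?q = "\<lambda>i x. w x * ((\<eta> (x - (t + s i) *\<^sub>R v) - \<eta> (x - t *\<^sub>R v)) / s i)"
    have "((LINT x|lebesgue_on S. w x * \<eta> (x - (t + s i) *\<^sub>R v))
      - (LINT x|lebesgue_on S. w x * \<eta> (x - t *\<^sub>R v))) / s i = (LINT x|lebesgue_on S. ?q i x)" for i
      by (simp add: Bochner_Integration.integral_diff[OF int int, symmetric] algebra_simps
          flip: integral_divide_zero)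
    moreover have "(\<lambda>i. LINT x|lebesgue_on S. ?q i x)
        \<longlonglongrightarrow> (LINT x|lebesgue_on S. w x * - dd \<eta> v (x - t *\<^sub>R v))"
    proof (rule integral_dominated_convergence)
      show "integrable (lebesgue_on S) (\<lambda>x. \<bar>w x\<bar> * (C * norm v))"
        using w by simp
      show "AE x in lebesgue_on S. (\<lambda>i. ?q i x) \<longlonglongrightarrow> w x * - dd \<eta> v (x - t *\<^sub>R v)"
        using pointwise s0 s unfolding tendsto_at_iff_sequentially comp_def
        by (intro AE_I2 tendsto_mult_left) blast
      show "AE x in lebesgue_on S. norm (?q i x) \<le> \<bar>w x\<bar> * (C * norm v)" for i
      proof (intro AE_I2)
        fix x
        have "\<bar>\<eta> (x - (t + s i) *\<^sub>R v) - \<eta> (x - t *\<^sub>R v)\<bar> \<le> C * norm (- (s i *\<^sub>R v))"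
          using C(2)[of "x - (t + s i) *\<^sub>R v" "x - t *\<^sub>R v"] by (simp add: algebra_simps)
        then have "\<bar>(\<eta> (x - (t + s i) *\<^sub>R v) - \<eta> (x - t *\<^sub>R v)) / s i\<bar> \<le> C * norm v"
          using s0 by (simp add: abs_divide pos_divide_le_eq mult_ac)
        then show "norm (?q i x) \<le> \<bar>w x\<bar> * (C * norm v)"
          unfolding real_norm_def abs_mult by (intro mult_left_mono) auto
      qed
    qed measurable
    ultimately show "(\<lambda>i. ((LINT x|lebesgue_on S. w x * \<eta> (x - (t + s i) *\<^sub>R v))
      - (LINT x|lebesgue_on S. w x * \<eta> (x - t *\<^sub>R v))) / s i)
        \<longlonglongrightarrow> (LINT x|lebesgue_on S. w x * - dd \<eta> v (x - t *\<^sub>R v))"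
      by (simp only:)
  qed
  then show ?thesis
    by (simp add: DERIV_def)
qed

text \<open>Integrals over the whole space do not change under translations, so their derivative along a
translation is zero.\<close>

lemma integral_dd_test_fun:
  assumes f: "f \<in> test_fun UNIV"
  shows "(LINT x|lebesgue. dd f v x) = 0"
proof -
  obtain K where K: "compact K" "K \<subseteq> UNIV" "\<And>x. x \<notin> K \<Longrightarrow> f x = 0"
    "\<And>x v. x \<notin> K \<Longrightarrow> dd f v x = 0"
    by (rule test_fun_support[OF f], rule that)
  obtain r where r: "\<And>x. x \<in> K \<Longrightarrow> norm x \<le> r"
    using compact_imp_bounded[OF K(1)] by (auto simp: bounded_iff)
  \<comment> \<open>The ball contains the support of \<open>f\<close> translated by \<open>t *\<^sub>R v\<close> for every \<open>\<bar>t\<bar> < 1\<close>.\<close>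
  define S where "S = cball (0::'a) (r + norm v)"
  have S: "S \<in> sets lebesgue"
    by (simp add: S_def)
  have "((\<lambda>t. LINT x|lebesgue_on S. 1 * f (x - t *\<^sub>R v)) has_real_derivative
      - (LINT x|lebesgue_on S. 1 * dd f v (x - 0 *\<^sub>R v))) (at 0)"
    by (rule DERIV_translated_integral[OF S _ f])
      (simp add: S_def finite_measure.integrable_const finite_measure_lebesgue_on)
  moreover have "((\<lambda>t. LINT x|lebesgue_on S. 1 * f (x - t *\<^sub>R v)) has_real_derivative 0) (at 0)"
  proof (rule has_field_derivative_transform_within_open)
    show "((\<lambda>t. LINT x|lebesgue. f x) has_real_derivative 0) (at 0)"
      by simp
    show "(LINT x|lebesgue. f x) = (LINT x|lebesgue_on S. 1 * f (x - t *\<^sub>R v))" if "t \<in> {-1<..<1}" for t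
    proof -
      have "f (x - t *\<^sub>R v) = 0" if "x \<notin> S" for x
      proof (rule K(3), rule notI)
        assume "x - t *\<^sub>R v \<in> K"
        then have "norm (x - t *\<^sub>R v) \<le> r"
          by (rule r)
        moreover have "norm x \<le> norm (x - t *\<^sub>R v) + \<bar>t\<bar> * norm v"
          using norm_triangle_sub[of x "t *\<^sub>R v"] by simp
        moreover have "\<bar>t\<bar> * norm v \<le> 1 * norm v"
          using \<open>t \<in> {-1<..<1}\<close> by (intro mult_right_mono) auto
        ultimately show False
          using that by (simp add: S_def)
      qed
      then show ?thesis
        using integral_lebesgue_on_superset[OF S, of "\<lambda>x. f (x - t *\<^sub>R v)"]
          integral_translation[OF test_fun_borel_measurable[OF f]] by simp
    qed
  qed auto
  ultimately have "(LINT x|lebesgue_on S. dd f v x) = 0"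
    using DERIV_unique by fastforce
  moreover have "dd f v x = 0" if "x \<notin> S" for x
  proof (rule K(4), rule notI)
    assume "x \<in> K"
    then show False
      using that r[of x] norm_ge_zero[of v] by (simp add: S_def)
  qed
  ultimately show ?thesis
    using integral_lebesgue_on_superset[OF S, of "dd f v"] by simp
qed

lemma integration_by_parts_test_fun:
  assumes U: "U \<in> sets lebesgue" and \<psi>: "\<psi> \<in> test_fun U" and \<eta>: "\<eta> \<in> test_fun UNIV"
  shows "(LINT x|lebesgue_on U. \<psi> x * dd \<eta> v x) = - (LINT x|lebesgue_on U. dd \<psi> v x * \<eta> x)"
proof -
  have "(\<lambda>x. \<psi> x * \<eta> x) \<in> test_fun UNIV"
    using test_fun_mult[OF test_fun_mono[OF \<psi>] test_fun_smooth[OF \<eta>]] by simp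
  then have "(LINT x|lebesgue. \<psi> x * dd \<eta> v x + dd \<psi> v x * \<eta> x) = 0"
    using integral_dd_test_fun[of "\<lambda>x. \<psi> x * \<eta> x" v]
    by (simp add: dd_mult[OF test_fun_smooth[OF \<psi>] test_fun_smooth[OF \<eta>]])
  then have "(LINT x|lebesgue_on U. \<psi> x * dd \<eta> v x + dd \<psi> v x * \<eta> x) = 0"
    using integral_lebesgue_on_superset[OF U, of "\<lambda>x. \<psi> x * dd \<eta> v x + dd \<psi> v x * \<eta> x"]
      test_fun_zero[OF \<psi>] by simp
  moreover have "integrable (lebesgue_on U) (\<lambda>x. \<psi> x * dd \<eta> v x)"
    "integrable (lebesgue_on U) (\<lambda>x. dd \<psi> v x * \<eta> x)"
    using test_fun_integrable[OF test_fun_mult[OF \<psi> test_fun_smooth[OF dd_test_fun[OF \<eta>]]] U]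
      test_fun_integrable[OF test_fun_mult[OF dd_test_fun[OF \<psi>] test_fun_smooth[OF \<eta>]] U] .
  ultimately show ?thesis
    by simp
qed

section \<open>Weak gradients\<close>

lemma integrable_lebesgue_on_subset:
  fixes f :: "'a::euclidean_space \<Rightarrow> 'b::euclidean_space"
  assumes "integrable (lebesgue_on U) f" "U \<in> sets lebesgue" "K \<in> sets lebesgue" "K \<subseteq> U"
  shows "integrable (lebesgue_on K) f"
proof -
  have "integrable lebesgue (\<lambda>x. indicator U x *\<^sub>R f x)"
    using assms by (subst (asm) integrable_restrict_space) simp_all
  then have "integrable lebesgue (\<lambda>x. indicator K x *\<^sub>R (indicator U x *\<^sub>R f x))"
    by (rule integrable_mult_indicator[OF assms(3)])
  also have "(\<lambda>x. indicator K x *\<^sub>R (indicator U x *\<^sub>R f x)) = (\<lambda>x. indicator K x *\<^sub>R f x)"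
    using assms(4) by (auto simp: indicator_def fun_eq_iff)
  finally show ?thesis
    using assms(3) by (subst integrable_restrict_space) simp_all
qed

lemma integrable_imp_L1_loc:
  "integrable (lebesgue_on U) f \<Longrightarrow> U \<in> sets lebesgue \<Longrightarrow> f \<in> L1_loc U"
  unfolding L1_loc_def
  by (clarify, rule integrable_lebesgue_on_subset[of U]) (simp_all add: compact_imp_closed)

lemma integrable_mult_bounded:
  fixes f b :: "'a \<Rightarrow> real"
  assumes "integrable M f" "b \<in> borel_measurable M" "\<And>x. \<bar>b x\<bar> \<le> C"
  shows "integrable M (\<lambda>x. f x * b x)"
proof (rule Bochner_Integration.integrable_bound)
  show "integrable M (\<lambda>x. C * f x)"
    using assms by simp
  show "AE x in M. norm (f x * b x) \<le> norm (C * f x)"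
  proof (intro AE_I2)
    fix x
    have "\<bar>b x\<bar> * \<bar>f x\<bar> \<le> \<bar>C\<bar> * \<bar>f x\<bar>"
      using assms(3)[of x] by (intro mult_right_mono) auto
    then show "norm (f x * b x) \<le> norm (C * f x)"
      by (simp add: abs_mult mult.commute)
  qed
qed (use assms in simp)

lemma L1_loc_mult_test_fun:
  fixes f :: "'a::euclidean_space \<Rightarrow> real"
  assumes f: "f \<in> L1_loc U" and \<psi>: "\<psi> \<in> test_fun U" and U: "U \<in> sets lebesgue"
  shows "integrable (lebesgue_on U) (\<lambda>x. f x * \<psi> x)"
proof -
  obtain K where K: "compact K" "K \<subseteq> U" "\<And>x. x \<notin> K \<Longrightarrow> \<psi> x = 0"
    "\<And>x v. x \<notin> K \<Longrightarrow> dd \<psi> v x = 0"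
    by (rule test_fun_support[OF \<psi>], rule that)
  obtain C where C: "\<And>x. \<bar>\<psi> x\<bar> \<le> C"
    using test_fun_bounded[OF \<psi>] by metis
  have Kl: "K \<in> sets lebesgue"
    using K(1) by (simp add: compact_imp_closed)
  have "integrable (lebesgue_on K) f"
    using f K(1,2) by (simp add: L1_loc_def)
  then have "integrable (lebesgue_on K) (\<lambda>x. f x * \<psi> x)"
    by (rule integrable_mult_bounded[OF _ test_fun_measurable[OF \<psi>] C])
  then have "integrable lebesgue (\<lambda>x. indicator K x *\<^sub>R (f x * \<psi> x))"
    using Kl by (subst (asm) integrable_restrict_space) simp_all
  also have "(\<lambda>x. indicator K x *\<^sub>R (f x * \<psi> x)) = (\<lambda>x. indicator U x *\<^sub>R (f x * \<psi> x))"
    using K(2,3) by (auto simp: indicator_def fun_eq_iff)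
  finally show ?thesis
    using U by (subst integrable_restrict_space) simp_all
qed

lemma L1_loc_inner:
  "g \<in> L1_loc U \<Longrightarrow> (\<lambda>x. g x \<bullet> v) \<in> L1_loc U"
  by (auto simp: L1_loc_def)

lemma has_weak_gradient_direction:
  assumes wg: "has_weak_gradient U w g" and \<psi>: "\<psi> \<in> test_fun U" and U: "U \<in> sets lebesgue"
  shows "(LINT x|lebesgue_on U. w x * dd \<psi> v x) = - (LINT x|lebesgue_on U. (g x \<bullet> v) * \<psi> x)"
proof -
  have w: "w \<in> L1_loc U" and g: "g \<in> L1_loc U"
    and parts: "\<And>b. b \<in> Basis \<Longrightarrow>
      (LINT x|lebesgue_on U. w x * dd \<psi> b x) = - (LINT x|lebesgue_on U. (g x \<bullet> b) * \<psi> x)"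
    using wg \<psi> by (auto simp: has_weak_gradient_def)
  have "(LINT x|lebesgue_on U. w x * dd \<psi> v x)
      = (LINT x|lebesgue_on U. (\<Sum>b\<in>Basis. (v \<bullet> b) * (w x * dd \<psi> b x)))"
    by (intro Bochner_Integration.integral_cong refl, subst dd_basis[OF test_fun_smooth[OF \<psi>]])
      (simp add: sum_distrib_left mult_ac)
  also have "\<dots> = (\<Sum>b\<in>Basis. (v \<bullet> b) * (LINT x|lebesgue_on U. w x * dd \<psi> b x))"
    using L1_loc_mult_test_fun[OF w dd_test_fun[OF \<psi>] U]
    by (simp add: Bochner_Integration.integral_sum)
  also have "\<dots> = (\<Sum>b\<in>Basis. - ((v \<bullet> b) * (LINT x|lebesgue_on U. (g x \<bullet> b) * \<psi> x)))"
    using parts by simp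
  also have "\<dots> = - (LINT x|lebesgue_on U. (\<Sum>b\<in>Basis. (v \<bullet> b) * ((g x \<bullet> b) * \<psi> x)))"
    using L1_loc_mult_test_fun[OF L1_loc_inner[OF g] \<psi> U]
    by (simp add: Bochner_Integration.integral_sum sum_negf)
  also have "\<dots> = - (LINT x|lebesgue_on U. (g x \<bullet> v) * \<psi> x)"
    by (simp add: euclidean_inner[of "g _" v] sum_distrib_left mult_ac)
  finally show ?thesis .
qed

section \<open>Extension by zero\<close>

lemma integral_mult_tendsto_L1:
  fixes f b :: "'a \<Rightarrow> real"
  assumes f: "integrable M f" "\<And>k. integrable M (F k)"
    and L1: "(\<lambda>k. LINT x|M. \<bar>f x - F k x\<bar>) \<longlonglongrightarrow> 0"
    and b: "b \<in> borel_measurable M" "\<And>x. \<bar>b x\<bar> \<le> C"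
  shows "(\<lambda>k. LINT x|M. F k x * b x) \<longlonglongrightarrow> (LINT x|M. f x * b x)"
proof -
  have "(\<lambda>k. (LINT x|M. F k x * b x) - (LINT x|M. f x * b x)) \<longlonglongrightarrow> 0"
  proof (rule Lim_null_comparison)
    have "\<bar>(LINT x|M. F k x * b x) - (LINT x|M. f x * b x)\<bar> \<le> (LINT x|M. \<bar>f x - F k x\<bar>) * C" for k
    proof -
      have "(LINT x|M. F k x * b x) - (LINT x|M. f x * b x) = (LINT x|M. (F k x - f x) * b x)"
        using integrable_mult_bounded[OF f(2) b] integrable_mult_bounded[OF f(1) b]
        by (simp add: left_diff_distrib)
      also have "\<bar>\<dots>\<bar> \<le> (LINT x|M. \<bar>f x - F k x\<bar> * C)"
      proof (rule order_trans[OF integral_abs_bound], rule integral_mono)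
        show "integrable M (\<lambda>x. \<bar>(F k x - f x) * b x\<bar>)"
          using f by (intro integrable_abs integrable_mult_bounded[OF _ b]) simp
        show "integrable M (\<lambda>x. \<bar>f x - F k x\<bar> * C)"
          using f by simp
        show "\<bar>(F k x - f x) * b x\<bar> \<le> \<bar>f x - F k x\<bar> * C" for x
          using b(2)[of x] by (simp add: abs_mult abs_minus_commute mult_left_mono)
      qed
      finally show ?thesis by simp
    qed
    then show "\<forall>\<^sub>F k in sequentially. norm ((LINT x|M. F k x * b x) - (LINT x|M. f x * b x))
        \<le> (LINT x|M. \<bar>f x - F k x\<bar>) * C"
      by simp
    show "(\<lambda>k. (LINT x|M. \<bar>f x - F k x\<bar>) * C) \<longlonglongrightarrow> 0"
      using tendsto_mult_right[OF L1, of C] by simp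
  qed
  then show ?thesis
    by (simp add: LIM_zero_iff)
qed

text \<open>Zero trace means that integration by parts has no boundary term: \<open>\<eta>\<close> need not vanish near the
boundary of \<open>U\<close>. For test functions in place of \<open>w\<close> this is integration by parts on the whole space,
and it survives the passage to the limit in \<open>W\<^sup>1\<^sup>,\<^sup>1\<close>.\<close>

lemma W0_1_1_integration_by_parts:
  assumes U: "U \<in> sets lebesgue" and w: "w \<in> W0_1_1 U"
  obtains g where "has_weak_gradient U w g" "integrable (lebesgue_on U) g"
    "\<And>\<eta> v. \<eta> \<in> test_fun UNIV \<Longrightarrow>
      (LINT x|lebesgue_on U. w x * dd \<eta> v x) = - (LINT x|lebesgue_on U. (g x \<bullet> v) * \<eta> x)"
proof -
  let ?M = "lebesgue_on U"
  obtain g \<psi> where w: "integrable ?M w" and g: "has_weak_gradient U w g" "integrable ?M g"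
    and \<psi>: "\<And>k. \<psi> k \<in> test_fun U"
    and lim: "(\<lambda>k. (LINT x|?M. \<bar>w x - \<psi> k x\<bar>) + (LINT x|?M. norm (g x - grad (\<psi> k) x))) \<longlonglongrightarrow> 0"
    using w by (auto simp: W0_1_1_def)
  have \<psi>_int: "integrable ?M (\<psi> k)" and d\<psi>_int: "integrable ?M (dd (\<psi> k) v)" for k v
    using test_fun_integrable[OF \<psi> U] test_fun_integrable[OF dd_test_fun[OF \<psi>] U] .
  have lim_w: "(\<lambda>k. LINT x|?M. \<bar>w x - \<psi> k x\<bar>) \<longlonglongrightarrow> 0"
    by (rule tendsto_sandwich[OF _ _ tendsto_const lim]) auto
  have lim_g: "(\<lambda>k. LINT x|?M. norm (g x - grad (\<psi> k) x)) \<longlonglongrightarrow> 0"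
    by (rule tendsto_sandwich[OF _ _ tendsto_const lim]) auto
  have lim_dir: "(\<lambda>k. LINT x|?M. \<bar>g x \<bullet> v - dd (\<psi> k) v x\<bar>) \<longlonglongrightarrow> 0" for v
  proof (rule tendsto_sandwich[OF _ _ tendsto_const])
    have "(LINT x|?M. \<bar>g x \<bullet> v - dd (\<psi> k) v x\<bar>) \<le> (LINT x|?M. norm v * norm (g x - grad (\<psi> k) x))" for k
    proof (rule integral_mono)
      show "\<bar>g x \<bullet> v - dd (\<psi> k) v x\<bar> \<le> norm v * norm (g x - grad (\<psi> k) x)" for x
        using Cauchy_Schwarz_ineq2[of v "g x - grad (\<psi> k) x"]
        by (simp add: dd_eq_grad[OF test_fun_smooth[OF \<psi>]] inner_diff_right inner_commute)
    qed (use g d\<psi>_int grad_test_fun_integrable[OF \<psi> U] in auto)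
    then show "\<forall>\<^sub>F k in sequentially. (LINT x|?M. \<bar>g x \<bullet> v - dd (\<psi> k) v x\<bar>)
        \<le> norm v * (LINT x|?M. norm (g x - grad (\<psi> k) x))"
      by simp
    show "(\<lambda>k. norm v * (LINT x|?M. norm (g x - grad (\<psi> k) x))) \<longlonglongrightarrow> 0"
      using tendsto_mult_left[OF lim_g, of "norm v"] by simp
  qed auto
  have "(LINT x|?M. w x * dd \<eta> v x) = - (LINT x|?M. (g x \<bullet> v) * \<eta> x)" if \<eta>: "\<eta> \<in> test_fun UNIV" for \<eta> v
  proof -
    obtain B where B: "\<And>x. \<bar>\<eta> x\<bar> \<le> B"
      using test_fun_bounded[OF \<eta>] by metis
    obtain C where C: "\<And>x. \<bar>dd \<eta> v x\<bar> \<le> C"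
      using test_fun_bounded[OF dd_test_fun[OF \<eta>]] by metis
    have "(\<lambda>k. LINT x|?M. \<psi> k x * dd \<eta> v x) \<longlonglongrightarrow> (LINT x|?M. w x * dd \<eta> v x)"
      by (rule integral_mult_tendsto_L1[OF w \<psi>_int lim_w test_fun_measurable[OF dd_test_fun[OF \<eta>]] C])
    moreover have "(\<lambda>k. LINT x|?M. dd (\<psi> k) v x * \<eta> x) \<longlonglongrightarrow> (LINT x|?M. (g x \<bullet> v) * \<eta> x)"
      using g by (intro integral_mult_tendsto_L1[OF _ d\<psi>_int lim_dir test_fun_measurable[OF \<eta>] B]) auto
    ultimately show ?thesis
      by (simp add: integration_by_parts_test_fun[OF U \<psi> \<eta>] LIMSEQ_unique tendsto_minus_cancel_left)
  qed
  with g that show thesis by blast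
qed

text \<open>An exhaustion by cut-off functions. Every open set has one; for balls it is explicit. Multiplication by
\<open>\<zeta> j\<close> turns a test function on the whole space into one on \<open>U\<close>.\<close>

definition has_cutoffs :: "'a::euclidean_space set \<Rightarrow> bool" where
  "has_cutoffs U \<longleftrightarrow> (\<exists>\<zeta>. (\<forall>j. \<zeta> j \<in> test_fun U) \<and> (\<forall>j x. 0 \<le> \<zeta> j x \<and> \<zeta> j x \<le> 1) \<and>
     (\<forall>x\<in>U. (\<lambda>j::nat. \<zeta> j x) \<longlonglongrightarrow> 1))"

text \<open>The gradient \<open>h\<close> obtained from the approximation by test functions is not known to satisfy the bound
of \<open>g\<close> pointwise. Both gradients have the same integrals against test functions in \<open>U\<close>, and cutting
\<open>\<eta>\<close> off inside \<open>U\<close> transfers the bound from \<open>g\<close> to averages of \<open>h\<close>.\<close>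

lemma weak_gradient_bound_up_to_boundary:
  assumes U: "U \<in> sets lebesgue" "has_cutoffs U"
    and g: "has_weak_gradient U w g" "AE x in lebesgue_on U. norm (g x) \<le> 1"
    and h: "has_weak_gradient U w h" "integrable (lebesgue_on U) h"
    and \<eta>: "\<eta> \<in> test_fun UNIV" "\<And>x. 0 \<le> \<eta> x"
  shows "(LINT x|lebesgue_on U. (h x \<bullet> v) * \<eta> x) \<le> norm v * (LINT x|lebesgue. \<eta> x)"
proof -
  let ?M = "lebesgue_on U"
  obtain \<zeta> where \<zeta>: "\<And>j. \<zeta> j \<in> test_fun U" "\<And>j x. 0 \<le> \<zeta> j x \<and> \<zeta> j x \<le> 1"
      "\<And>x. x \<in> U \<Longrightarrow> (\<lambda>j::nat. \<zeta> j x) \<longlonglongrightarrow> 1"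
    using U(2) unfolding has_cutoffs_def by metis
  have \<zeta>\<eta>: "(\<lambda>x. \<zeta> j x * \<eta> x) \<in> test_fun U" for j
    by (rule test_fun_mult[OF \<zeta>(1) test_fun_smooth[OF \<eta>(1)]])
  obtain C where C: "\<And>x. \<bar>\<eta> x\<bar> \<le> C"
    using test_fun_bounded[OF \<eta>(1)] by metis
  have [measurable]: "\<eta> \<in> borel_measurable ?M" "\<zeta> j \<in> borel_measurable ?M" for j
    using test_fun_measurable \<eta>(1) \<zeta>(1) by blast+
  have [measurable]: "h \<in> borel_measurable ?M"
    using h(2) by auto
  have gL: "g \<in> L1_loc U"
    using g(1) by (simp add: has_weak_gradient_def)
  have \<eta>_int: "integrable ?M \<eta>" "integrable lebesgue \<eta>"
    using test_fun_integrable[OF \<eta>(1) U(1)] test_fun_integrable[OF \<eta>(1), of UNIV]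
    by (simp_all add: lebesgue_on_UNIV_eq)
  have "(LINT x|?M. (h x \<bullet> v) * (\<zeta> j x * \<eta> x)) \<le> norm v * (LINT x|lebesgue. \<eta> x)" for j
  proof -
    have "(LINT x|?M. (h x \<bullet> v) * (\<zeta> j x * \<eta> x)) = (LINT x|?M. (g x \<bullet> v) * (\<zeta> j x * \<eta> x))"
      using has_weak_gradient_direction[OF g(1) \<zeta>\<eta>[of j] U(1), of v]
        has_weak_gradient_direction[OF h(1) \<zeta>\<eta>[of j] U(1), of v] by simp
    also have "\<dots> \<le> (LINT x|?M. norm v * \<eta> x)"
    proof (rule integral_mono_AE)
      show "integrable ?M (\<lambda>x. (g x \<bullet> v) * (\<zeta> j x * \<eta> x))"
        by (rule L1_loc_mult_test_fun[OF L1_loc_inner[OF gL] \<zeta>\<eta> U(1)])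
      show "integrable ?M (\<lambda>x. norm v * \<eta> x)"
        using \<eta>_int by simp
      show "AE x in ?M. (g x \<bullet> v) * (\<zeta> j x * \<eta> x) \<le> norm v * \<eta> x"
        using g(2)
      proof eventually_elim
        case (elim x)
        have "g x \<bullet> v \<le> norm (g x) * norm v"
          using Cauchy_Schwarz_ineq2[of "g x" v] by simp
        also have "\<dots> \<le> 1 * norm v"
          using elim by (intro mult_right_mono) auto
        finally have "(g x \<bullet> v) * (\<zeta> j x * \<eta> x) \<le> norm v * (\<zeta> j x * \<eta> x)"
          using \<zeta>(2)[of j x] \<eta>(2)[of x] by (intro mult_right_mono) auto
        also have "\<dots> \<le> norm v * (1 * \<eta> x)"
          using \<zeta>(2)[of j x] \<eta>(2)[of x] by (intro mult_left_mono mult_right_mono) auto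
        finally show ?case by simp
      qed
    qed
    also have "\<dots> \<le> norm v * (LINT x|lebesgue. \<eta> x)"
    proof -
      have "(LINT x|?M. \<eta> x) = (LINT x|lebesgue. indicator U x *\<^sub>R \<eta> x)"
        using U(1) by (subst integral_restrict_space) simp_all
      also have "\<dots> \<le> (LINT x|lebesgue. \<eta> x)"
        using \<eta>(2) \<eta>_int integrable_mult_indicator[OF U(1) \<eta>_int(2)]
        by (intro integral_mono) (auto simp: indicator_def)
      finally show ?thesis
        by (simp add: mult_left_mono)
    qed
    finally show ?thesis .
  qed
  moreover have "(\<lambda>j. LINT x|?M. (h x \<bullet> v) * (\<zeta> j x * \<eta> x)) \<longlonglongrightarrow> (LINT x|?M. (h x \<bullet> v) * (1 * \<eta> x))"
  proof (rule integral_dominated_convergence)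
    show "integrable ?M (\<lambda>x. \<bar>h x \<bullet> v\<bar> * C)"
      using h(2) by simp
    show "AE x in ?M. (\<lambda>j. (h x \<bullet> v) * (\<zeta> j x * \<eta> x)) \<longlonglongrightarrow> (h x \<bullet> v) * (1 * \<eta> x)"
      by (intro AE_I2 tendsto_intros \<zeta>(3)) simp
    show "AE x in ?M. norm ((h x \<bullet> v) * (\<zeta> j x * \<eta> x)) \<le> \<bar>h x \<bullet> v\<bar> * C" for j
    proof (intro AE_I2)
      fix x
      have "\<bar>\<zeta> j x\<bar> * \<bar>\<eta> x\<bar> \<le> 1 * C"
        using \<zeta>(2)[of j x] C[of x] by (intro mult_mono) auto
      then show "norm ((h x \<bullet> v) * (\<zeta> j x * \<eta> x)) \<le> \<bar>h x \<bullet> v\<bar> * C"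
        unfolding real_norm_def abs_mult by (intro mult_left_mono) auto
    qed
  qed measurable
  ultimately show ?thesis
    by (simp add: LIMSEQ_le_const2)
qed

text \<open>The derivative of the average of \<open>w\<close> along the translation is an average of the gradient; the mean
value theorem on the unit interval integrates the bound.\<close>

lemma translated_integral_difference_le:
  assumes U: "U \<in> sets lebesgue" and w: "integrable (lebesgue_on U) w"
    and parts: "\<And>\<eta> v. \<eta> \<in> test_fun UNIV \<Longrightarrow>
      (LINT x|lebesgue_on U. w x * dd \<eta> v x) = - (LINT x|lebesgue_on U. (h x \<bullet> v) * \<eta> x)"
    and bound: "\<And>\<eta> v. \<eta> \<in> test_fun UNIV \<Longrightarrow> (\<And>x. 0 \<le> \<eta> x) \<Longrightarrow>
      (LINT x|lebesgue_on U. (h x \<bullet> v) * \<eta> x) \<le> norm v * (LINT x|lebesgue. \<eta> x)"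
    and \<eta>: "\<eta> \<in> test_fun UNIV" "\<And>x. 0 \<le> \<eta> x"
  shows "(LINT x|lebesgue_on U. w x * \<eta> (x - v)) - (LINT x|lebesgue_on U. w x * \<eta> x)
    \<le> norm v * (LINT x|lebesgue. \<eta> x)"
proof -
  let ?\<Psi> = "\<lambda>t. LINT x|lebesgue_on U. w x * \<eta> (x - t *\<^sub>R v)"
  obtain t where t: "?\<Psi> 1 - ?\<Psi> 0 = (1 - 0) * - (LINT x|lebesgue_on U. w x * dd \<eta> v (x - t *\<^sub>R v))"
    using MVT2[of 0 1 ?\<Psi>, OF zero_less_one DERIV_translated_integral[OF U w \<eta>(1)]] by blast
  define \<eta>' where "\<eta>' x = \<eta> (x - t *\<^sub>R v)" for x
  have \<eta>': "\<eta>' \<in> test_fun UNIV"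
    unfolding \<eta>'_def by (rule test_fun_translate[OF \<eta>(1)])
  have "dd \<eta>' v x = dd \<eta> v (x - t *\<^sub>R v)" for x
    unfolding \<eta>'_def by (rule dd_translate[OF test_fun_smooth[OF \<eta>(1)]])
  then have "?\<Psi> 1 - ?\<Psi> 0 = (LINT x|lebesgue_on U. (h x \<bullet> v) * \<eta>' x)"
    using t parts[OF \<eta>', of v] by simp
  also have "\<dots> \<le> norm v * (LINT x|lebesgue. \<eta>' x)"
    by (rule bound[OF \<eta>']) (simp add: \<eta>'_def \<eta>(2))
  also have "(LINT x|lebesgue. \<eta>' x) = (LINT x|lebesgue. \<eta> x)"
    unfolding \<eta>'_def by (rule integral_translation[OF test_fun_borel_measurable[OF \<eta>(1)]])
  finally show ?thesis by simp
qed

section \<open>Bumps and cut-offs\<close>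

lemma flat_exp_0: "t \<le> 0 \<Longrightarrow> flat_exp 0 t = 0" "t > 0 \<Longrightarrow> flat_exp 0 t = exp (- 1 / t)"
  by (simp_all add: flat_exp_def)

lemma flat_exp_0_bounds: "0 \<le> flat_exp 0 t" "flat_exp 0 t \<le> 1"
  by (simp_all add: flat_exp_def)

lemma flat_exp_0_mono: "s \<le> t \<Longrightarrow> flat_exp 0 s \<le> flat_exp 0 t"
  by (auto simp: flat_exp_def intro: divide_left_mono)

lemma flat_exp_0_at_top: "(flat_exp 0 \<longlongrightarrow> 1) at_top"
proof -
  have "((\<lambda>t::real. - 1 / t) \<longlongrightarrow> 0) at_top"
    by (rule tendsto_divide_0[OF tendsto_const filterlim_at_top_imp_at_infinity[OF filterlim_ident]])
  from tendsto_exp[OF this] have "((\<lambda>t::real. exp (- 1 / t)) \<longlongrightarrow> 1) at_top"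
    by simp
  then show ?thesis
    by (rule Lim_transform_eventually)
      (use eventually_gt_at_top[of 0] in \<open>eventually_elim, simp add: flat_exp_0\<close>)
qed

lemma has_cutoffs_ball: "has_cutoffs (ball c R)"
proof -
  define a where "a x = R\<^sup>2 - (norm (x - c))\<^sup>2" for x
  \<comment> \<open>Non-zero only where \<open>real j * a x > 1\<close>, which is at a positive distance from the sphere.\<close>
  define \<zeta> where "\<zeta> j x = flat_exp 0 (real j * a x - 1)" for j x
  have a: "smooth a"
    unfolding a_def[abs_def] by (intro smooth_diff smooth_const smooth_norm_power2)
  show ?thesis
  proof (cases "R > 0")
    case False
    then have "ball c R = {}"
      by simp
    moreover have "(\<lambda>_. 0) \<in> test_fun {}"
      by (rule test_funI[of _ "{}"]) auto
    ultimately show ?thesis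
      unfolding has_cutoffs_def by (metis empty_iff order_refl zero_le_one)
  next
    case True
    have inside: "x \<in> ball c R" if "a x > 0" for x
      using that True power2_less_imp_less[of "norm (x - c)" R]
      by (simp add: a_def dist_norm norm_minus_commute)
    have pos: "a x > 0" if "x \<in> ball c R" for x
      using that by (simp add: a_def dist_norm norm_minus_commute power_strict_mono)
    have "\<zeta> j \<in> test_fun (ball c R)" for j
    proof (rule test_funI)
      let ?K = "{x. 1 \<le> real j * a x}"
      show "smooth (\<zeta> j)"
        unfolding \<zeta>_def
        by (intro smooth_compose[OF smooth_flat_exp] smooth_diff smooth_mult smooth_const a)
      have K: "?K \<subseteq> ball c R"
      proof
        fix x assume "x \<in> ?K"
        then have "0 < real j * a x" by simp
        then show "x \<in> ball c R"
          by (intro inside) (simp add: zero_less_mult_iff)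
      qed
      moreover have "closed ?K"
        by (intro closed_Collect_le continuous_on_const continuous_on_mult smooth_continuous_on[OF a])
      ultimately show "compact ?K"
        by (auto simp: compact_eq_bounded_closed intro: bounded_subset[OF bounded_ball])
      show "?K \<subseteq> ball c R" by (rule K)
      show "\<zeta> j x = 0" if "x \<notin> ?K" for x
        using that by (simp add: \<zeta>_def flat_exp_0)
    qed
    moreover have "(\<lambda>j. \<zeta> j x) \<longlonglongrightarrow> 1" if "x \<in> ball c R" for x
    proof -
      have "filterlim (\<lambda>j. real j * a x) at_top sequentially"
        using pos[OF that] filterlim_at_top_mult_tendsto_pos[OF tendsto_const _ filterlim_real_sequentially]
        by blast
      then have "filterlim (\<lambda>j. - 1 + real j * a x) at_top sequentially"
        by (intro filterlim_tendsto_add_at_top[OF tendsto_const])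
      then show ?thesis
        unfolding \<zeta>_def by (intro filterlim_compose[OF flat_exp_0_at_top]) (simp add: algebra_simps)
    qed
    ultimately show ?thesis
      unfolding has_cutoffs_def
      by (intro exI[of _ \<zeta>]) (simp add: \<zeta>_def flat_exp_0_bounds)
  qed
qed

text \<open>The complements \<open>1 - \<zeta>\<close> are multiplied, so that the result tends to \<open>1\<close> wherever one of the two
sequences does.\<close>

lemma has_cutoffs_Un:
  assumes "has_cutoffs U" "has_cutoffs V"
  shows "has_cutoffs (U \<union> V)"
proof -
  obtain \<zeta> where \<zeta>: "\<And>j. \<zeta> j \<in> test_fun U" "\<And>j x. 0 \<le> \<zeta> j x \<and> \<zeta> j x \<le> 1"
      "\<And>x. x \<in> U \<Longrightarrow> (\<lambda>j::nat. \<zeta> j x) \<longlonglongrightarrow> 1"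
    using assms(1) unfolding has_cutoffs_def by metis
  obtain \<xi> where \<xi>: "\<And>j. \<xi> j \<in> test_fun V" "\<And>j x. 0 \<le> \<xi> j x \<and> \<xi> j x \<le> 1"
      "\<And>x. x \<in> V \<Longrightarrow> (\<lambda>j::nat. \<xi> j x) \<longlonglongrightarrow> 1"
    using assms(2) unfolding has_cutoffs_def by metis
  define \<rho> where "\<rho> j x = \<zeta> j x + \<xi> j x * (1 - \<zeta> j x)" for j x
  have compl: "\<rho> j x = 1 - (1 - \<zeta> j x) * (1 - \<xi> j x)" for j x
    by (simp add: \<rho>_def algebra_simps)
  have "\<rho> j \<in> test_fun (U \<union> V)" for j
    unfolding \<rho>_def
    by (intro test_fun_add test_fun_mult test_fun_mono[OF \<zeta>(1)] test_fun_mono[OF \<xi>(1)]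
        smooth_diff smooth_const test_fun_smooth[OF \<zeta>(1)]) auto
  moreover have "0 \<le> \<rho> j x \<and> \<rho> j x \<le> 1" for j x
    using \<zeta>(2)[of j x] \<xi>(2)[of j x] by (simp add: compl mult_le_one)
  moreover have "(\<lambda>j. \<rho> j x) \<longlonglongrightarrow> 1" if x: "x \<in> U \<union> V" for x
  proof -
    have b: "\<bar>1 - \<zeta> j x\<bar> \<le> 1" "\<bar>1 - \<xi> j x\<bar> \<le> 1" for j
      using \<zeta>(2)[of j x] \<xi>(2)[of j x] by auto
    have "(\<lambda>j. (1 - \<zeta> j x) * (1 - \<xi> j x)) \<longlonglongrightarrow> 0"
    proof (cases "x \<in> U")
      case True
      show ?thesis
      proof (rule Lim_null_comparison)
        show "\<forall>\<^sub>F j in sequentially. norm ((1 - \<zeta> j x) * (1 - \<xi> j x)) \<le> \<bar>1 - \<zeta> j x\<bar>"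
          using b by (auto simp: abs_mult intro!: always_eventually mult_right_le_one_le)
        show "(\<lambda>j. \<bar>1 - \<zeta> j x\<bar>) \<longlonglongrightarrow> 0"
          using tendsto_rabs[OF tendsto_diff[OF tendsto_const \<zeta>(3)[OF True]], of 1] by simp
      qed
    next
      case False
      with x have V: "x \<in> V" by simp
      show ?thesis
      proof (rule Lim_null_comparison)
        show "\<forall>\<^sub>F j in sequentially. norm ((1 - \<zeta> j x) * (1 - \<xi> j x)) \<le> \<bar>1 - \<xi> j x\<bar>"
          using b by (auto simp: abs_mult intro!: always_eventually mult_left_le_one_le)
        show "(\<lambda>j. \<bar>1 - \<xi> j x\<bar>) \<longlonglongrightarrow> 0"
          using tendsto_rabs[OF tendsto_diff[OF tendsto_const \<xi>(3)[OF V]], of 1] by simp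
      qed
    qed
    from tendsto_diff[OF tendsto_const this, of 1] show ?thesis
      by (simp add: compl)
  qed
  ultimately show ?thesis
    unfolding has_cutoffs_def by blast
qed

lemma bump_exists:
  fixes p :: "'a::euclidean_space"
  assumes "r > 0"
  obtains \<eta> where "\<eta> \<in> test_fun UNIV" "\<And>x. 0 \<le> \<eta> x" "\<And>x. norm (x - p) \<ge> r \<Longrightarrow> \<eta> x = 0"
    "0 < (LINT x|lebesgue. \<eta> x)"
proof
  let ?\<eta> = "\<lambda>x. flat_exp 0 (r\<^sup>2 - (norm (x - p))\<^sup>2)"
  show zero: "?\<eta> x = 0" if "norm (x - p) \<ge> r" for x
    using that assms by (intro flat_exp_0(1)) (simp add: power_mono)
  show \<eta>: "?\<eta> \<in> test_fun UNIV"
  proof (rule test_funI)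
    show "smooth ?\<eta>"
      by (intro smooth_compose[OF smooth_flat_exp] smooth_diff smooth_const smooth_norm_power2)
    show "?\<eta> x = 0" if "x \<notin> cball p r" for x
      using that by (intro zero) (simp add: dist_norm norm_minus_commute)
  qed auto
  show "0 \<le> ?\<eta> x" for x
    by (rule flat_exp_0_bounds)
  let ?B = "ball p (r / 2)" and ?c = "flat_exp 0 (r\<^sup>2 / 2)"
  have le: "?c * indicator ?B x \<le> ?\<eta> x" for x
  proof (cases "x \<in> ?B")
    case True
    then have "norm (x - p) \<le> r / 2"
      by (simp add: dist_norm norm_minus_commute)
    then have "(norm (x - p))\<^sup>2 \<le> (r / 2)\<^sup>2"
      by (rule power_mono) simp
    then have "4 * (norm (x - p))\<^sup>2 \<le> r\<^sup>2"
      by (simp add: power_divide)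
    then have "r\<^sup>2 / 2 \<le> r\<^sup>2 - (norm (x - p))\<^sup>2"
      using zero_le_power2[of "norm (x - p)"] by linarith
    then show ?thesis
      using True flat_exp_0_mono by simp
  qed (simp add: flat_exp_0_bounds)
  have ind: "integrable lebesgue (indicat_real ?B)"
    using lmeasurable_ball[of p "r / 2"] by (intro integrable_real_indicator) (auto simp: fmeasurable_def)
  have "0 < ?c * measure lebesgue ?B"
    using assms content_ball_pos[of "r / 2" p] by (simp add: flat_exp_def)
  also have "\<dots> = (LINT x|lebesgue. ?c * indicator ?B x)"
    by simp
  also have "\<dots> \<le> (LINT x|lebesgue. ?\<eta> x)"
    using le ind test_fun_integrable[OF \<eta>, of UNIV]
    by (intro integral_mono) (simp_all add: lebesgue_on_UNIV_eq)
  finally show "0 < (LINT x|lebesgue. ?\<eta> x)" .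
qed

section \<open>Functions of zero trace with bounded gradient are Lipschitz\<close>

text \<open>The bridge between averages and point values. The extension by zero allows the support of \<open>\<eta>\<close> to leave
\<open>U\<close>.\<close>

lemma local_average:
  fixes w \<eta> :: "'a::euclidean_space \<Rightarrow> real"
  assumes U: "U \<in> sets lebesgue" and w: "integrable (lebesgue_on U) w"
    and \<eta>: "\<eta> \<in> test_fun UNIV" "\<And>x. 0 \<le> \<eta> x"
    and near: "\<And>y. \<eta> y \<noteq> 0 \<Longrightarrow> \<bar>(if y \<in> U then w y else 0) - a\<bar> \<le> e"
  shows "\<bar>(LINT y|lebesgue_on U. w y * \<eta> y) - a * (LINT y|lebesgue. \<eta> y)\<bar> \<le> e * (LINT y|lebesgue. \<eta> y)"
proof -
  let ?W = "\<lambda>y. if y \<in> U then w y else 0"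
  obtain C where C: "\<And>x. \<bar>\<eta> x\<bar> \<le> C"
    using test_fun_bounded[OF \<eta>(1)] by metis
  have \<eta>_int: "integrable lebesgue \<eta>"
    using test_fun_integrable[OF \<eta>(1), of UNIV] by (simp add: lebesgue_on_UNIV_eq)
  have eq: "(if y \<in> U then w y * \<eta> y else 0) = ?W y * \<eta> y" for y
    by simp
  have "integrable (lebesgue_on U) (\<lambda>y. w y * \<eta> y)"
    by (rule integrable_mult_bounded[OF w test_fun_measurable[OF \<eta>(1)] C])
  then have W_int: "integrable lebesgue (\<lambda>y. ?W y * \<eta> y)"
    using Lebesgue_Measure.integrable_restrict_UNIV[OF U, of "\<lambda>y. w y * \<eta> y"] unfolding eq by simp
  have "(LINT y|lebesgue_on U. w y * \<eta> y) - a * (LINT y|lebesgue. \<eta> y)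
      = (LINT y|lebesgue. (?W y - a) * \<eta> y)"
    using Lebesgue_Measure.integral_restrict_UNIV[OF U, of "\<lambda>y. w y * \<eta> y"] W_int \<eta>_int
    unfolding eq by (simp add: left_diff_distrib)
  also have "\<bar>\<dots>\<bar> \<le> (LINT y|lebesgue. e * \<eta> y)"
  proof (rule order_trans[OF integral_abs_bound], rule integral_mono)
    have "integrable lebesgue (\<lambda>y. ?W y * \<eta> y - a * \<eta> y)"
      using W_int \<eta>_int by simp
    then show "integrable lebesgue (\<lambda>y. \<bar>(?W y - a) * \<eta> y\<bar>)"
      by (intro integrable_abs) (simp only: left_diff_distrib)
    show "integrable lebesgue (\<lambda>y. e * \<eta> y)"
      using \<eta>_int by simp
    show "\<bar>(?W y - a) * \<eta> y\<bar> \<le> e * \<eta> y" for y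
    proof (cases "\<eta> y = 0")
      case False
      from mult_right_mono[OF near[OF this] \<eta>(2)[of y]] show ?thesis
        unfolding abs_mult abs_of_nonneg[OF \<eta>(2)] .
    qed simp
  qed
  finally show ?thesis by simp
qed

text \<open>At boundary points of \<open>U\<close> the continuity of the extension by zero is not yet known; they are
therefore excluded here and in the Lipschitz estimate, and are reached as limits of exterior points.\<close>

lemma zero_extension_continuous:
  fixes w :: "'a::euclidean_space \<Rightarrow> real"
  assumes U: "open U" and w: "continuous_on U w" and x: "x \<in> U \<or> x \<notin> closure U" and e: "e > 0"
  obtains r where "r > 0"
    "\<And>y. norm (y - x) < r \<Longrightarrow> \<bar>(if y \<in> U then w y else 0) - (if x \<in> U then w x else 0)\<bar> \<le> e"
proof (cases "x \<in> U")
  case True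
  obtain s where s: "s > 0" "ball x s \<subseteq> U"
    using U True openE by blast
  obtain d where d: "d > 0" "\<And>y. y \<in> U \<Longrightarrow> dist y x < d \<Longrightarrow> dist (w y) (w x) < e"
    using w True e unfolding continuous_on_iff by blast
  have "\<bar>(if y \<in> U then w y else 0) - (if x \<in> U then w x else 0)\<bar> \<le> e" if "norm (y - x) < min s d" for y
  proof -
    have "y \<in> U"
      using that s(2) by (auto simp: dist_norm norm_minus_commute)
    then show ?thesis
      using d(2)[of y] True that by (simp add: dist_norm)
  qed
  with s(1) d(1) that[of "min s d"] show thesis by simp
next
  case False
  with x have "x \<in> - closure U" by simp
  then obtain s where s: "s > 0" "ball x s \<subseteq> - closure U"
    using open_Compl[OF closed_closure] openE by blast
  have "y \<notin> U" if "norm (y - x) < s" for y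
    using that s(2) subsetD[OF closure_subset, of y U] by (auto simp: dist_norm norm_minus_commute)
  with s(1) False e that[of s] show thesis by simp
qed

text \<open>The average of \<open>w\<close> over a small bump translated from \<open>p\<close> to \<open>x\<close> exceeds the average at \<open>p\<close> by at
most \<open>norm (x - p)\<close>. As the bump shrinks, the averages become point values.
The segment from \<open>p\<close> to \<open>x\<close> may cross the boundary of \<open>U\<close>, which is how the zero boundary values enter.\<close>

lemma W0_zero_extension_lipschitz:
  fixes w :: "'a::euclidean_space \<Rightarrow> real"
  assumes U: "open U" "has_cutoffs U" and w: "w \<in> W0_1_1 U" "continuous_on U w"
    and g: "has_weak_gradient U w g" "AE x in lebesgue_on U. norm (g x) \<le> 1"
    and x: "x \<in> U \<or> x \<notin> closure U" and p: "p \<in> U \<or> p \<notin> closure U"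
  shows "(if x \<in> U then w x else 0) - (if p \<in> U then w p else 0) \<le> norm (x - p)"
proof -
  let ?W = "\<lambda>y. if y \<in> U then w y else 0"
  have Ul: "U \<in> sets lebesgue"
    using U(1) by simp
  have w_int: "integrable (lebesgue_on U) w"
    using w(1) by (simp add: W0_1_1_def)
  obtain h where h: "has_weak_gradient U w h" "integrable (lebesgue_on U) h"
    "\<And>\<eta> v. \<eta> \<in> test_fun UNIV \<Longrightarrow>
      (LINT x|lebesgue_on U. w x * dd \<eta> v x) = - (LINT x|lebesgue_on U. (h x \<bullet> v) * \<eta> x)"
    by (rule W0_1_1_integration_by_parts[OF Ul w(1)], rule that)
  have "?W x - ?W p \<le> norm (x - p) + e" if "e > 0" for e
  proof -
    have e2: "e / 2 > 0" using that by simp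
    obtain r where r: "r > 0" "\<And>y. norm (y - x) < r \<Longrightarrow> \<bar>?W y - ?W x\<bar> \<le> e / 2"
      by (rule zero_extension_continuous[OF U(1) w(2) x e2], rule that)
    obtain s where s: "s > 0" "\<And>y. norm (y - p) < s \<Longrightarrow> \<bar>?W y - ?W p\<bar> \<le> e / 2"
      by (rule zero_extension_continuous[OF U(1) w(2) p e2], rule that)
    have rs: "min r s > 0"
      using r(1) s(1) by simp
    obtain \<eta> where \<eta>: "\<eta> \<in> test_fun UNIV" "\<And>x. 0 \<le> \<eta> x"
      "\<And>x. norm (x - p) \<ge> min r s \<Longrightarrow> \<eta> x = 0" "0 < (LINT x|lebesgue. \<eta> x)"
      by (rule bump_exists[OF rs, of p], rule that)
    let ?I = "LINT x|lebesgue. \<eta> x" and ?v = "x - p"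
    have "\<bar>(LINT y|lebesgue_on U. w y * \<eta> y) - ?W p * ?I\<bar> \<le> e / 2 * ?I"
    proof (rule local_average[OF Ul w_int \<eta>(1,2)])
      show "\<bar>?W y - ?W p\<bar> \<le> e / 2" if "\<eta> y \<noteq> 0" for y
        using that \<eta>(3)[of y] by (intro s(2)) linarith
    qed
    moreover have "\<bar>(LINT y|lebesgue_on U. w y * \<eta> (y - ?v)) - ?W x * (LINT y|lebesgue. \<eta> (y - ?v))\<bar>
        \<le> e / 2 * (LINT y|lebesgue. \<eta> (y - ?v))"
    proof (rule local_average[OF Ul w_int test_fun_translate[OF \<eta>(1)] \<eta>(2)])
      show "\<bar>?W y - ?W x\<bar> \<le> e / 2" if "\<eta> (y - ?v) \<noteq> 0" for y
      proof (rule r(2))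
        have "y - ?v - p = y - x" by simp
        then have "\<not> min r s \<le> norm (y - x)"
          using that \<eta>(3)[of "y - ?v"] by auto
        then show "norm (y - x) < r" by linarith
      qed
    qed
    moreover have "(LINT y|lebesgue_on U. w y * \<eta> (y - ?v)) - (LINT y|lebesgue_on U. w y * \<eta> y)
        \<le> norm ?v * ?I"
      using translated_integral_difference_le[OF Ul w_int h(3)
          weak_gradient_bound_up_to_boundary[OF Ul U(2) g h(1,2)] \<eta>(1,2)] .
    moreover have "(a - b) * I \<le> (n + e) * I"
      if "\<bar>B - b * I\<bar> \<le> e / 2 * I" "\<bar>A - a * I\<bar> \<le> e / 2 * I" "A - B \<le> n * I"
      for A B I a b n :: real
    proof -
      have "a * I - e / 2 * I \<le> A" "B \<le> b * I + e / 2 * I"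
        using that(1,2) unfolding abs_le_iff by linarith+
      then have "a * I - b * I \<le> n * I + e * I"
        using that(3) by linarith
      then show ?thesis
        by (simp add: left_diff_distrib distrib_right)
    qed
    ultimately have "(?W x - ?W p) * ?I \<le> (norm ?v + e) * ?I"
      unfolding integral_translation[OF test_fun_borel_measurable[OF \<eta>(1)]] by blast
    then show ?thesis
      using \<eta>(4) by simp
  qed
  then show ?thesis
    by (rule field_le_epsilon)
qed

section \<open>Limits of test functions\<close>

text \<open>On a bounded set, uniform bounds turn pointwise convergence of test functions and of their gradients
into convergence in \<open>W\<^sup>1\<^sup>,\<^sup>1\<close>, by dominated convergence.\<close>

lemma W0_1_inf_limit:
  fixes u :: "'a::euclidean_space \<Rightarrow> real" and g :: "'a \<Rightarrow> 'a"
  assumes U: "open U" "bounded U" and \<psi>: "\<And>k. \<psi> k \<in> test_fun U"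
    and bound: "\<And>k x. x \<in> U \<Longrightarrow> \<bar>\<psi> k x\<bar> \<le> C" "\<And>k x. x \<in> U \<Longrightarrow> norm (grad (\<psi> k) x) \<le> 1"
    and lim: "\<And>x. x \<in> U \<Longrightarrow> (\<lambda>k. \<psi> k x) \<longlonglongrightarrow> u x" "\<And>x. x \<in> U \<Longrightarrow> (\<lambda>k. grad (\<psi> k) x) \<longlonglongrightarrow> g x"
  shows "u \<in> W0_1_inf U" "has_weak_gradient U u g" "Linf_norm U g \<le> 1"
proof -
  let ?M = "lebesgue_on U"
  have Ul: "U \<in> sets lebesgue"
    using U(1) by simp
  interpret finite_measure ?M
    by (intro finite_measure_lebesgue_on lmeasurable_open U)
  have [measurable]: "\<psi> k \<in> borel_measurable ?M" "grad (\<psi> k) \<in> borel_measurable ?M" for k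
    using test_fun_measurable[OF \<psi>] grad_test_fun_integrable[OF \<psi> Ul] by auto
  have dd_meas [measurable]: "dd (\<psi> k) v \<in> borel_measurable ?M" for k v
    by (rule test_fun_measurable[OF dd_test_fun[OF \<psi>]])
  have [measurable]: "u \<in> borel_measurable ?M"
    by (rule borel_measurable_LIMSEQ_real[of _ \<psi>]) (simp_all add: lim)
  have [measurable]: "g \<in> borel_measurable ?M"
    by (rule borel_measurable_LIMSEQ_metric[of "\<lambda>k. grad (\<psi> k)"]) (simp_all add: lim)
  have u_bound: "\<bar>u x\<bar> \<le> C" and g_bound: "norm (g x) \<le> 1" if "x \<in> U" for x
    using LIMSEQ_le_const2[OF tendsto_rabs[OF lim(1)[OF that]]] bound(1)[OF that]
      LIMSEQ_le_const2[OF tendsto_norm[OF lim(2)[OF that]]] bound(2)[OF that] by blast+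
  have u_int: "integrable ?M u" and g_int: "integrable ?M g"
    using integrable_const_bound[OF AE_I2[of ?M "\<lambda>x. norm (u x) \<le> C"]]
      integrable_const_bound[OF AE_I2[of ?M "\<lambda>x. norm (g x) \<le> 1"]] u_bound g_bound by simp_all
  show wg: "has_weak_gradient U u g"
    unfolding has_weak_gradient_def
  proof (intro conjI ballI)
    show "u \<in> L1_loc U" "g \<in> L1_loc U"
      using integrable_imp_L1_loc[OF u_int Ul] integrable_imp_L1_loc[OF g_int Ul] .
    fix \<eta> :: "'a \<Rightarrow> real" and b :: 'a
    assume \<eta>: "\<eta> \<in> test_fun U"
    have [measurable]: "\<eta> \<in> borel_measurable ?M" "dd \<eta> b \<in> borel_measurable ?M"
      by (rule test_fun_measurable[OF \<eta>], rule test_fun_measurable[OF dd_test_fun[OF \<eta>]])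
    have "(\<lambda>k. LINT x|?M. \<psi> k x * dd \<eta> b x) \<longlonglongrightarrow> (LINT x|?M. u x * dd \<eta> b x)"
    proof (rule integral_dominated_convergence)
      show "integrable ?M (\<lambda>x. C * \<bar>dd \<eta> b x\<bar>)"
        using test_fun_integrable[OF dd_test_fun[OF \<eta>] Ul] by simp
      show "AE x in ?M. (\<lambda>k. \<psi> k x * dd \<eta> b x) \<longlonglongrightarrow> u x * dd \<eta> b x"
        by (intro AE_I2 tendsto_mult_right lim) simp
      show "AE x in ?M. norm (\<psi> k x * dd \<eta> b x) \<le> C * \<bar>dd \<eta> b x\<bar>" for k
        by (intro AE_I2) (simp add: abs_mult mult_right_mono bound)
    qed measurable
    moreover have "(\<lambda>k. LINT x|?M. dd (\<psi> k) b x * \<eta> x) \<longlonglongrightarrow> (LINT x|?M. (g x \<bullet> b) * \<eta> x)"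
    proof (rule integral_dominated_convergence)
      show "integrable ?M (\<lambda>x. norm b * \<bar>\<eta> x\<bar>)"
        using test_fun_integrable[OF \<eta> Ul] by simp
      show "AE x in ?M. (\<lambda>k. dd (\<psi> k) b x * \<eta> x) \<longlonglongrightarrow> (g x \<bullet> b) * \<eta> x"
        unfolding dd_eq_grad[OF test_fun_smooth[OF \<psi>]] inner_commute[of b]
        by (intro AE_I2 tendsto_mult_right tendsto_inner tendsto_const lim) simp
      show "AE x in ?M. norm (dd (\<psi> k) b x * \<eta> x) \<le> norm b * \<bar>\<eta> x\<bar>" for k
      proof (intro AE_I2)
        fix x assume "x \<in> space ?M"
        then have "norm (grad (\<psi> k) x) \<le> 1"
          using bound(2) by simp
        then have "\<bar>dd (\<psi> k) b x\<bar> \<le> norm b * 1"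
          unfolding dd_eq_grad[OF test_fun_smooth[OF \<psi>]]
          by (intro order_trans[OF Cauchy_Schwarz_ineq2] mult_left_mono) auto
        then show "norm (dd (\<psi> k) b x * \<eta> x) \<le> norm b * \<bar>\<eta> x\<bar>"
          by (simp add: abs_mult mult_right_mono)
      qed
    qed measurable
    ultimately show "(LINT x|?M. u x * dd \<eta> b x) = - (LINT x|?M. (g x \<bullet> b) * \<eta> x)"
      unfolding integration_by_parts_test_fun[OF Ul \<psi> test_fun_mono[OF \<eta> subset_UNIV]]
      by (rule LIMSEQ_unique[OF _ tendsto_minus])
  qed
  show Lg: "Linf_norm U g \<le> 1"
    unfolding Linf_norm_def using g_bound
    by (intro esssup_I) (auto intro!: AE_I2 simp: ennreal_le_1)
  have "Linf_norm U u \<le> ennreal C"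
    unfolding Linf_norm_def using u_bound
    by (intro esssup_I) (auto intro!: AE_I2 ennreal_leI)
  then have "u \<in> Linf U" "g \<in> Linf U"
    using Lg by (auto simp: Linf_def intro: le_less_trans[of _ 1] le_less_trans[of _ "ennreal C"])
  then have "u \<in> W1_inf U"
    using wg by (auto simp: W1_inf_def)
  moreover have "u \<in> W0_1_1 U"
  proof -
    have "(\<lambda>k. LINT x|?M. \<bar>u x - \<psi> k x\<bar>) \<longlonglongrightarrow> (LINT x|?M. 0)"
    proof (rule integral_dominated_convergence)
      show "AE x in ?M. (\<lambda>k. \<bar>u x - \<psi> k x\<bar>) \<longlonglongrightarrow> 0"
      proof (intro AE_I2)
        fix x assume "x \<in> space ?M"
        then show "(\<lambda>k. \<bar>u x - \<psi> k x\<bar>) \<longlonglongrightarrow> 0"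
          using tendsto_rabs[OF tendsto_diff[OF tendsto_const lim(1)], of x "u x"] by simp
      qed
      show "AE x in ?M. norm \<bar>u x - \<psi> k x\<bar> \<le> C + C" for k
      proof (intro AE_I2)
        fix x assume "x \<in> space ?M"
        then show "norm \<bar>u x - \<psi> k x\<bar> \<le> C + C"
          using u_bound[of x] bound(1)[of x k] by simp
      qed
    qed (measurable; simp)+
    moreover have "(\<lambda>k. LINT x|?M. norm (g x - grad (\<psi> k) x)) \<longlonglongrightarrow> (LINT x|?M. 0)"
    proof (rule integral_dominated_convergence)
      show "AE x in ?M. (\<lambda>k. norm (g x - grad (\<psi> k) x)) \<longlonglongrightarrow> 0"
      proof (intro AE_I2)
        fix x assume "x \<in> space ?M"
        then show "(\<lambda>k. norm (g x - grad (\<psi> k) x)) \<longlonglongrightarrow> 0"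
          using tendsto_norm[OF tendsto_diff[OF tendsto_const lim(2)], of x "g x"] by simp
      qed
      show "AE x in ?M. norm (norm (g x - grad (\<psi> k) x)) \<le> 1 + 1" for k
      proof (intro AE_I2)
        fix x assume "x \<in> space ?M"
        then show "norm (norm (g x - grad (\<psi> k) x)) \<le> 1 + 1"
          using g_bound[of x] bound(2)[of x k] norm_triangle_ineq4[of "g x" "grad (\<psi> k) x"] by simp
      qed
    qed (measurable; simp)+
    ultimately have "(\<lambda>k. (LINT x|?M. \<bar>u x - \<psi> k x\<bar>) + (LINT x|?M. norm (g x - grad (\<psi> k) x)))
        \<longlonglongrightarrow> 0"
      using tendsto_add by fastforce
    then show ?thesis
      unfolding W0_1_1_def using u_int wg g_int \<psi> by blast
  qed
  ultimately show "u \<in> W0_1_inf U"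
    by (simp add: W0_1_inf_def)
qed

section \<open>Smoothed tent functions\<close>

text \<open>The tent over the shell of radius \<open>m\<close> and half-width \<open>a\<close>. For \<open>m = 0\<close> it is the cone over the ball of
radius \<open>a\<close>, so that both configurations are covered by one family.\<close>

definition tent :: "'a::euclidean_space \<Rightarrow> real \<Rightarrow> real \<Rightarrow> 'a \<Rightarrow> real" where
  "tent c m a x = max 0 (a - \<bar>norm (x - c) - m\<bar>)"

definition tent_grad :: "'a::euclidean_space \<Rightarrow> real \<Rightarrow> real \<Rightarrow> 'a \<Rightarrow> 'a" where
  "tent_grad c m a x =
     (if \<bar>norm (x - c) - m\<bar> < a then - sgn (norm (x - c) - m) *\<^sub>R sgn (x - c) else 0)"

lemma tent_nonneg: "0 \<le> tent c m a x"
  by (simp add: tent_def)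

lemma continuous_on_tent: "continuous_on S (tent c m a)"
  unfolding tent_def[abs_def]
  by (intro continuous_on_max continuous_on_diff continuous_on_rabs continuous_on_norm
      continuous_on_const continuous_on_id)

lemma tent_eq_0_outside: "a \<ge> 0 \<Longrightarrow> x \<notin> ball c (m + a) \<Longrightarrow> tent c m a x = 0"
  by (simp add: tent_def dist_norm norm_minus_commute)

lemma tent_radial: "dist c x = dist c y \<Longrightarrow> tent c m a x = tent c m a y"
  by (simp add: tent_def dist_norm norm_minus_commute)

definition soft_abs :: "real \<Rightarrow> real \<Rightarrow> real" where
  "soft_abs e t = sqrt (t\<^sup>2 + e\<^sup>2)"

text \<open>A smooth substitute for \<open>max 0 t\<close>, namely \<open>t * exp (- e / t)\<close> for \<open>t > 0\<close>. It is chosen because it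
never exceeds slope \<open>1\<close>, although it vanishes to infinite order at \<open>0\<close>; in the variable \<open>s = t / e\<close>
its derivative is the function \<open>soft_pos_deriv\<close> below.\<close>

definition soft_pos :: "real \<Rightarrow> real \<Rightarrow> real" where
  "soft_pos e t = t * flat_exp 0 (t / e)"

definition soft_pos_deriv :: "real \<Rightarrow> real" where
  "soft_pos_deriv s = flat_exp 0 s + s * flat_exp 2 s"

lemma soft_abs_bounds:
  assumes "e > 0"
  shows "soft_abs e t > 0" "e \<le> soft_abs e t" "\<bar>t\<bar> \<le> soft_abs e t" "soft_abs e t \<le> \<bar>t\<bar> + e"
proof -
  show "soft_abs e t > 0"
    using assms unfolding soft_abs_def real_sqrt_gt_0_iff by (intro add_nonneg_pos) auto
  show "e \<le> soft_abs e t" "\<bar>t\<bar> \<le> soft_abs e t"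
    unfolding soft_abs_def by (rule real_le_rsqrt; simp)+
  show "soft_abs e t \<le> \<bar>t\<bar> + e"
    using assms unfolding soft_abs_def by (intro real_le_lsqrt) (simp_all add: power2_sum)
qed

lemma soft_abs_dist_le:
  assumes "e > 0" "r \<ge> 0"
  shows "r \<le> soft_abs e r" "\<bar>\<bar>soft_abs e r - m\<bar> - \<bar>r - m\<bar>\<bar> \<le> e"
proof -
  show r: "r \<le> soft_abs e r"
    using soft_abs_bounds(3)[OF assms(1), of r] by simp
  have "soft_abs e r \<le> r + e"
    using soft_abs_bounds(4)[OF assms(1), of r] assms(2) by simp
  with r show "\<bar>\<bar>soft_abs e r - m\<bar> - \<bar>r - m\<bar>\<bar> \<le> e"
    using abs_triangle_ineq3[of "soft_abs e r - m" "r - m"] by simp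
qed

lemma smooth_soft_abs: "e > 0 \<Longrightarrow> smooth f \<Longrightarrow> smooth (\<lambda>x. soft_abs e (f x))"
  unfolding soft_abs_def power2_eq_square
  by (intro smooth_sqrt smooth_add smooth_mult smooth_const) (auto intro: add_nonneg_pos)

lemma smooth_soft_norm: "e > 0 \<Longrightarrow> smooth (\<lambda>x. soft_abs e (norm (x - c)))"
  unfolding soft_abs_def
  by (intro smooth_sqrt smooth_add smooth_norm_power2 smooth_const) (auto intro: add_nonneg_pos)

lemma smooth_soft_pos: "smooth f \<Longrightarrow> smooth (\<lambda>x. soft_pos e (f x))"
  unfolding soft_pos_def divide_inverse
  by (intro smooth_mult smooth_compose[OF smooth_flat_exp] smooth_const)

lemma DERIV_soft_abs:
  assumes "e > 0"
  shows "(soft_abs e has_real_derivative t / soft_abs e t) (at t)"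
proof -
  have "0 < t\<^sup>2 + e\<^sup>2"
    using assms by (intro add_nonneg_pos) auto
  then show ?thesis
    unfolding soft_abs_def[abs_def]
    by (auto intro!: derivative_eq_intros simp: field_simps)
qed

lemma DERIV_soft_pos:
  assumes "e > 0"
  shows "(soft_pos e has_real_derivative soft_pos_deriv (t / e)) (at t)"
proof -
  have "(flat_exp 0 has_real_derivative flat_exp 2 s) (at s)" for s
    using flat_exp_has_derivative[of 0 s] by (simp add: has_field_derivative_def numeral_2_eq_2)
  from DERIV_chain2[OF this DERIV_cdivide[OF DERIV_ident, of e]]
  have "((\<lambda>t. flat_exp 0 (t / e)) has_real_derivative flat_exp 2 (t / e) * (1 / e)) (at t)" .
  from DERIV_mult[OF DERIV_ident this] show ?thesis
    by (simp add: soft_pos_def[abs_def] soft_pos_deriv_def add.commute mult.commute)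
qed

lemma soft_pos_deriv_eq:
  "soft_pos_deriv s = (if s > 0 then (1 + 1 / s) * exp (- (1 / s)) else 0)"
  by (simp add: soft_pos_deriv_def flat_exp_def power2_eq_square field_simps)

text \<open>This is the inequality \<open>1 + y \<le> exp y\<close> for \<open>y = 1 / s\<close>.\<close>

lemma soft_pos_deriv_bounds: "0 \<le> soft_pos_deriv s" "soft_pos_deriv s \<le> 1"
proof -
  show "0 \<le> soft_pos_deriv s"
    by (simp add: soft_pos_deriv_eq)
  have "(1 + 1 / s) * exp (- (1 / s)) \<le> 1" if "s > 0"
    using exp_ge_add_one_self[of "1 / s"] by (simp add: exp_minus pos_divide_le_eq flip: divide_inverse)
  then show "soft_pos_deriv s \<le> 1"
    by (simp add: soft_pos_deriv_eq)
qed

lemma soft_pos_deriv_at_top: "(soft_pos_deriv \<longlongrightarrow> 1) at_top"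
proof -
  have "((\<lambda>s::real. 1 / s) \<longlongrightarrow> 0) at_top"
    by (rule tendsto_divide_0[OF tendsto_const filterlim_at_top_imp_at_infinity[OF filterlim_ident]])
  from tendsto_mult[OF tendsto_add[OF tendsto_const this] tendsto_exp[OF tendsto_minus[OF this]]]
  have "((\<lambda>s::real. (1 + 1 / s) * exp (- (1 / s))) \<longlongrightarrow> 1) at_top"
    by simp
  then show ?thesis
    by (rule Lim_transform_eventually)
      (use eventually_gt_at_top[of 0] in \<open>eventually_elim, simp add: soft_pos_deriv_eq\<close>)
qed

lemma soft_pos_bounds:
  assumes "e > 0"
  shows "0 \<le> soft_pos e t" "soft_pos e t \<le> max 0 t" "max 0 t - e \<le> soft_pos e t"
proof -
  show "0 \<le> soft_pos e t"
    using flat_exp_0_bounds(1)[of "t / e"] assms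
    by (cases "t > 0") (simp_all add: soft_pos_def flat_exp_0 divide_nonpos_pos)
  show "soft_pos e t \<le> max 0 t"
    using flat_exp_0_bounds(2)[of "t / e"] assms
    by (cases "t > 0") (simp_all add: soft_pos_def flat_exp_0 divide_nonpos_pos mult_left_le)
  show "max 0 t - e \<le> soft_pos e t"
  proof (cases "t > 0")
    case True
    have "t * (1 + - (e / t)) \<le> t * exp (- (e / t))"
      using True by (intro mult_left_mono exp_ge_add_one_self) simp
    with True show ?thesis
      using assms by (simp add: soft_pos_def flat_exp_0 algebra_simps)
  qed (use assms \<open>0 \<le> soft_pos e t\<close> in simp)
qed

text \<open>The inner \<open>soft_abs\<close> removes the singularity of the norm at \<open>c\<close>, the outer one the ridge at distance
\<open>m\<close>. The additional \<open>- e\<close> moves the support into a compact subset of the ball, and it makes the argument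
of \<open>soft_pos\<close> at most \<open>a - \<bar>norm (x - c) - m\<bar>\<close>.\<close>

definition soft_tent :: "'a::euclidean_space \<Rightarrow> real \<Rightarrow> real \<Rightarrow> real \<Rightarrow> 'a \<Rightarrow> real" where
  "soft_tent c m a e x = soft_pos e (a - e - soft_abs e (soft_abs e (norm (x - c)) - m))"

lemma has_derivative_inner_compose:
  assumes "(f has_derivative (\<lambda>v. G \<bullet> v)) (at x)" "(\<phi> has_real_derivative d) (at (f x))"
  shows "((\<lambda>x. \<phi> (f x)) has_derivative (\<lambda>v. (d *\<^sub>R G) \<bullet> v)) (at x)"
  using has_derivative_compose[OF assms(1) assms(2)[unfolded has_field_derivative_def]]
  by simp

lemma grad_soft_tent:
  fixes x c :: "'a::euclidean_space"
  assumes "e > 0"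
  defines "N \<equiv> soft_abs e (norm (x - c))"
  shows "grad (soft_tent c m a e) x = - (soft_pos_deriv ((a - e - soft_abs e (N - m)) / e)
      * ((N - m) / soft_abs e (N - m))) *\<^sub>R ((1 / N) *\<^sub>R (x - c))"
proof (rule grad_eq)
  have "((\<lambda>x. (norm (x - c))\<^sup>2) has_derivative (\<lambda>v. (2 *\<^sub>R (x - c)) \<bullet> v)) (at x)"
    unfolding power2_norm_eq_inner
    by (auto intro!: derivative_eq_intros simp: inner_commute)
  moreover have "0 < (norm (x - c))\<^sup>2 + e\<^sup>2"
    using assms(1) by (intro add_nonneg_pos) auto
  then have "((\<lambda>t. sqrt (t + e\<^sup>2)) has_real_derivative 1 / (2 * N)) (at ((norm (x - c))\<^sup>2))"
    unfolding N_def soft_abs_def by (auto intro!: derivative_eq_intros simp: field_simps)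
  ultimately have "((\<lambda>x. sqrt ((norm (x - c))\<^sup>2 + e\<^sup>2)) has_derivative
      (\<lambda>v. ((1 / (2 * N)) *\<^sub>R (2 *\<^sub>R (x - c))) \<bullet> v)) (at x)"
    by (rule has_derivative_inner_compose)
  then have "((\<lambda>x. soft_abs e (norm (x - c))) has_derivative (\<lambda>v. ((1 / N) *\<^sub>R (x - c)) \<bullet> v)) (at x)"
    by (simp add: soft_abs_def)
  moreover have "((\<lambda>n. soft_pos e (a - e - soft_abs e (n - m))) has_real_derivative
      - (soft_pos_deriv ((a - e - soft_abs e (N - m)) / e) * ((N - m) / soft_abs e (N - m)))) (at N)"
  proof -
    have "((\<lambda>n. soft_abs e (n - m)) has_real_derivative (N - m) / soft_abs e (N - m) * 1) (at N)"
      by (rule DERIV_chain2[OF DERIV_soft_abs[OF assms(1)]]) (auto intro!: derivative_eq_intros)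
    then have "((\<lambda>n. a - e - soft_abs e (n - m)) has_real_derivative
        0 - (N - m) / soft_abs e (N - m) * 1) (at N)"
      by (rule DERIV_diff[OF DERIV_const])
    from DERIV_chain2[OF DERIV_soft_pos[OF assms(1)] this] show ?thesis
      by simp
  qed
  ultimately show "(soft_tent c m a e has_derivative
      (\<lambda>v. (- (soft_pos_deriv ((a - e - soft_abs e (N - m)) / e)
      * ((N - m) / soft_abs e (N - m))) *\<^sub>R ((1 / N) *\<^sub>R (x - c))) \<bullet> v)) (at x)"
    unfolding soft_tent_def[abs_def] N_def by (rule has_derivative_inner_compose)
qed

lemma norm_grad_soft_tent:
  assumes "e > 0"
  shows "norm (grad (soft_tent c m a e) x) \<le> 1"
proof -
  have unit: "\<bar>t / soft_abs e t\<bar> \<le> 1" for t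
    using soft_abs_bounds[OF assms, of t] by (simp add: abs_divide)
  let ?N = "soft_abs e (norm (x - c))"
  have "norm ((1 / ?N) *\<^sub>R (x - c)) \<le> 1"
    using soft_abs_bounds[OF assms, of "norm (x - c)"] by simp
  moreover have "\<bar>soft_pos_deriv s * (t / soft_abs e t)\<bar> \<le> 1 * 1" for s t
    unfolding abs_mult using soft_pos_deriv_bounds[of s] by (intro mult_mono unit) auto
  ultimately show ?thesis
    unfolding grad_soft_tent[OF assms]
    by (subst norm_scaleR) (intro mult_le_one, simp_all only: abs_minus_cancel norm_ge_zero mult_1)
qed

lemma soft_tent_test_fun:
  assumes "e > 0"
  shows "soft_tent c m a e \<in> test_fun (ball c (m + a))"
proof (rule test_funI)
  show "smooth (soft_tent c m a e)"
    unfolding soft_tent_def[abs_def]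
    by (intro smooth_soft_pos smooth_diff smooth_const smooth_soft_abs smooth_soft_norm assms)
  show "compact (cball c (m + a - e))" "cball c (m + a - e) \<subseteq> ball c (m + a)"
    using assms by auto
  show "soft_tent c m a e x = 0" if "x \<notin> cball c (m + a - e)" for x
  proof -
    let ?N = "soft_abs e (norm (x - c))"
    have "m + a - e < norm (x - c)"
      using that by (simp add: dist_norm norm_minus_commute)
    also have "\<dots> \<le> ?N"
      using soft_abs_bounds(3)[OF assms, of "norm (x - c)"] by simp
    finally have "a - e - soft_abs e (?N - m) \<le> 0"
      using soft_abs_bounds(3)[OF assms, of "?N - m"] by linarith
    then show ?thesis
      using assms by (simp add: soft_tent_def soft_pos_def flat_exp_0 divide_nonpos_pos)
  qed
qed

lemma soft_tent_close:
  assumes "e > 0"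
  shows "\<bar>soft_tent c m a e x - tent c m a x\<bar> \<le> 4 * e"
proof -
  let ?r = "norm (x - c)"
  let ?N = "soft_abs e ?r"
  let ?t = "a - e - soft_abs e (?N - m)"
  have "\<bar>soft_pos e ?t - max 0 ?t\<bar> \<le> e"
    using soft_pos_bounds[OF assms, of ?t] by linarith
  moreover have "\<bar>?t - (a - \<bar>?r - m\<bar>)\<bar> \<le> 3 * e"
    using soft_abs_bounds(3,4)[OF assms, of "?N - m"] soft_abs_dist_le(2)[OF assms, of ?r m] assms
    unfolding abs_le_iff[where b = e] abs_le_iff[where b = "3 * e"] by auto
  moreover have "\<bar>max 0 s - max 0 t\<bar> \<le> \<bar>s - t\<bar>" for s t :: real
    by (auto simp: max_def)
  then have "\<bar>max 0 ?t - max 0 (a - \<bar>?r - m\<bar>)\<bar> \<le> \<bar>?t - (a - \<bar>?r - m\<bar>)\<bar>" .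
  moreover have "\<bar>x - z\<bar> \<le> 4 * e"
    if "\<bar>x - y\<bar> \<le> e" "\<bar>y - z\<bar> \<le> d" "d \<le> 3 * e" for x y z d :: real
    using that by linarith
  ultimately have "\<bar>soft_pos e ?t - max 0 (a - \<bar>?r - m\<bar>)\<bar> \<le> 4 * e"
    by blast
  then show ?thesis
    by (simp only: soft_tent_def tent_def)
qed

lemma soft_tent_bounds: "e > 0 \<Longrightarrow> a \<ge> 0 \<Longrightarrow> \<bar>soft_tent c m a e x\<bar> \<le> a"
  using soft_pos_bounds(1,2)[of e "a - e - soft_abs e (soft_abs e (norm (x - c)) - m)"]
    soft_abs_bounds(1)[of e "soft_abs e (norm (x - c)) - m"]
  unfolding soft_tent_def by linarith

lemma soft_tent_tendsto:
  assumes e: "\<And>k. e k > 0" "e \<longlonglongrightarrow> 0"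
  shows "(\<lambda>k. soft_tent c m a (e k) x) \<longlonglongrightarrow> tent c m a x"
proof -
  have "(\<lambda>k. soft_tent c m a (e k) x - tent c m a x) \<longlonglongrightarrow> 0"
  proof (rule Lim_null_comparison)
    show "\<forall>\<^sub>F k in sequentially. norm (soft_tent c m a (e k) x - tent c m a x) \<le> 4 * e k"
      using soft_tent_close[OF e(1)] by (intro always_eventually allI) simp
    show "(\<lambda>k. 4 * e k) \<longlonglongrightarrow> 0"
      using tendsto_mult_left[OF e(2), of 4] by simp
  qed
  then show ?thesis
    by (simp add: LIM_zero_iff)
qed

lemma soft_abs_tendsto:
  assumes "e \<longlonglongrightarrow> 0" "t \<longlonglongrightarrow> s"
  shows "(\<lambda>k. soft_abs (e k) (t k)) \<longlonglongrightarrow> \<bar>s\<bar>"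
proof -
  have "(\<lambda>k. sqrt ((t k)\<^sup>2 + (e k)\<^sup>2)) \<longlonglongrightarrow> sqrt (s\<^sup>2 + 0\<^sup>2)"
    by (intro tendsto_intros assms)
  then show ?thesis
    by (simp add: soft_abs_def)
qed

text \<open>On the ridge \<open>r = m\<close> the quotient tends to \<open>0 = sgn 0\<close>, since the numerator is of order \<open>e\<^sup>2\<close> and the
denominator at least \<open>e\<close>. Hence the gradients converge at every point and not only almost everywhere.\<close>

lemma soft_sgn_tendsto:
  assumes e: "\<And>k. e k > 0" "e \<longlonglongrightarrow> 0" and r: "r > 0"
  defines "N \<equiv> \<lambda>k. soft_abs (e k) r"
  shows "(\<lambda>k. (N k - m) / soft_abs (e k) (N k - m)) \<longlonglongrightarrow> sgn (r - m)"
proof -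
  have N: "N \<longlonglongrightarrow> r"
    using soft_abs_tendsto[OF e(2) tendsto_const, of r] r by (simp add: N_def)
  show ?thesis
  proof (cases "r = m")
    case False
    have "(\<lambda>k. (N k - m) / soft_abs (e k) (N k - m)) \<longlonglongrightarrow> (r - m) / \<bar>r - m\<bar>"
      using False by (intro tendsto_divide soft_abs_tendsto e tendsto_diff N tendsto_const) simp
    moreover have "(r - m) / \<bar>r - m\<bar> = sgn (r - m)"
      using False by (simp add: sgn_div_norm divide_inverse_commute)
    ultimately show ?thesis
      by simp
  next
    case True
    have bound: "norm ((N k - m) / soft_abs (e k) (N k - m)) \<le> e k / m" for k
    proof -
      have "(N k)\<^sup>2 = m\<^sup>2 + (e k)\<^sup>2"
        using True by (simp add: N_def soft_abs_def)
      then have "(N k - m) * (N k + m) = (e k)\<^sup>2"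
        by (simp add: algebra_simps power2_eq_square)
      moreover have Nm: "0 \<le> N k - m"
        using soft_abs_bounds(3)[OF e(1)[of k], of r] True by (simp add: N_def)
      then have "(N k - m) * m \<le> (N k - m) * (N k + m)"
        using r True by (intro mult_left_mono) auto
      ultimately have "N k - m \<le> (e k)\<^sup>2 / m"
        using r True by (simp add: pos_le_divide_eq)
      then have "(N k - m) / soft_abs (e k) (N k - m) \<le> (e k)\<^sup>2 / m / e k"
        using soft_abs_bounds(1,2)[OF e(1)[of k], of "N k - m"] e(1)[of k] r True
        by (intro frac_le) auto
      then show ?thesis
        using Nm soft_abs_bounds(1)[OF e(1)[of k], of "N k - m"] e(1)[of k]
        by (simp add: power2_eq_square)
    qed
    have lim: "(\<lambda>k. e k / m) \<longlonglongrightarrow> 0"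
      using tendsto_divide[OF e(2) tendsto_const, of m] r True by simp
    have "(\<lambda>k. (N k - m) / soft_abs (e k) (N k - m)) \<longlonglongrightarrow> 0"
      by (rule Lim_null_comparison[OF always_eventually[OF allI[OF bound]] lim])
    then show ?thesis
      using True by simp
  qed
qed

text \<open>Where the tent vanishes, all approximations have gradient zero; at the centre \<open>c\<close> the factor \<open>x - c\<close>
vanishes; elsewhere the three factors of the gradient converge separately.\<close>

lemma grad_soft_tent_tendsto:
  assumes e: "\<And>k. e k > 0" "e \<longlonglongrightarrow> 0"
  shows "(\<lambda>k. grad (soft_tent c m a (e k)) x) \<longlonglongrightarrow> tent_grad c m a x"
proof -
  define r where "r = norm (x - c)"
  define N where "N k = soft_abs (e k) r" for k
  define t where "t k = a - e k - soft_abs (e k) (N k - m)" for k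
  have N: "N \<longlonglongrightarrow> r"
    using soft_abs_tendsto[OF e(2) tendsto_const, of r] by (simp add: N_def[abs_def] r_def)
  have grad: "grad (soft_tent c m a (e k)) x =
      - (soft_pos_deriv (t k / e k) * ((N k - m) / soft_abs (e k) (N k - m))) *\<^sub>R ((1 / N k) *\<^sub>R (x - c))"
    for k
    using grad_soft_tent[OF e(1)] by (simp add: t_def N_def r_def)
  consider "\<bar>r - m\<bar> \<ge> a" | "r = 0" | "\<bar>r - m\<bar> < a" "r > 0"
    unfolding r_def by (metis less_eq_real_def norm_ge_zero not_less)
  then show ?thesis
  proof cases
    case 1
    have "t k \<le> 0" for k
      using 1 soft_abs_bounds(3)[OF e(1)[of k], of "N k - m"] soft_abs_dist_le(2)[OF e(1)[of k], of r m]
      unfolding t_def N_def abs_le_iff[where b = "e k"] by (simp add: r_def)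
    then have "t k / e k \<le> 0" for k
      using e(1)[of k] by (intro divide_nonpos_pos)
    then have "grad (soft_tent c m a (e k)) x = 0" for k
      by (simp add: grad soft_pos_deriv_eq leD)
    then show ?thesis
      using 1 by (simp add: tent_grad_def r_def)
  next
    case 2
    then have "grad (soft_tent c m a (e k)) x = 0" for k
      unfolding grad by (simp add: r_def)
    then show ?thesis
      using 2 by (simp add: r_def tent_grad_def)
  next
    case 3
    have "t \<longlonglongrightarrow> a - 0 - \<bar>r - m\<bar>"
      unfolding t_def by (intro tendsto_diff tendsto_const soft_abs_tendsto e N)
    moreover have "0 < a - 0 - \<bar>r - m\<bar>"
      using 3(1) by linarith
    moreover have "filterlim (\<lambda>k. inverse (e k)) at_top sequentially"
      by (rule filterlim_inverse_at_top[OF e(2)]) (simp add: e(1))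
    ultimately have "filterlim (\<lambda>k. t k * inverse (e k)) at_top sequentially"
      by (rule filterlim_tendsto_pos_mult_at_top)
    then have "filterlim (\<lambda>k. t k / e k) at_top sequentially"
      by (simp add: divide_inverse)
    then have "(\<lambda>k. soft_pos_deriv (t k / e k)) \<longlonglongrightarrow> 1"
      by (rule filterlim_compose[OF soft_pos_deriv_at_top])
    moreover have "(\<lambda>k. (N k - m) / soft_abs (e k) (N k - m)) \<longlonglongrightarrow> sgn (r - m)"
      unfolding N_def by (rule soft_sgn_tendsto[OF e 3(2)])
    moreover have "(\<lambda>k. (1 / N k) *\<^sub>R (x - c)) \<longlonglongrightarrow> (1 / r) *\<^sub>R (x - c)"
      using 3(2) by (intro tendsto_intros N) simp
    ultimately have "(\<lambda>k. - (soft_pos_deriv (t k / e k) * ((N k - m) / soft_abs (e k) (N k - m)))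
        *\<^sub>R ((1 / N k) *\<^sub>R (x - c))) \<longlonglongrightarrow> - (1 * sgn (r - m)) *\<^sub>R ((1 / r) *\<^sub>R (x - c))"
      by (rule tendsto_scaleR[OF tendsto_minus[OF tendsto_mult]])
    then show ?thesis
      using 3 unfolding grad by (simp add: tent_grad_def r_def sgn_div_norm inverse_eq_divide)
  qed
qed

section \<open>Admissible functions\<close>

lemma reciprocal_null_sequence: "0 < 1 / real (Suc k)" "(\<lambda>k. 1 / real (Suc k)) \<longlonglongrightarrow> 0"
  using LIMSEQ_inverse_real_of_nat by (simp_all add: inverse_eq_divide)

lemma admissibleI:
  fixes u :: "'a::euclidean_space \<Rightarrow> real"
  assumes \<psi>: "\<And>k. \<psi> k \<in> test_fun (ball O\<^sub>1 R\<^sub>1 \<union> ball O\<^sub>2 R\<^sub>2)"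
    and bound: "\<And>k x. x \<in> ball O\<^sub>1 R\<^sub>1 \<union> ball O\<^sub>2 R\<^sub>2 \<Longrightarrow> \<bar>\<psi> k x\<bar> \<le> C"
      "\<And>k x. x \<in> ball O\<^sub>1 R\<^sub>1 \<union> ball O\<^sub>2 R\<^sub>2 \<Longrightarrow> norm (grad (\<psi> k) x) \<le> 1"
    and lim: "\<And>x. (\<lambda>k. \<psi> k x) \<longlonglongrightarrow> u x" "\<And>x. (\<lambda>k. grad (\<psi> k) x) \<longlonglongrightarrow> g x"
    and u: "continuous_on UNIV u" "radially_symmetric_on O\<^sub>1 (ball O\<^sub>1 R\<^sub>1) u"
      "radially_symmetric_on O\<^sub>2 (ball O\<^sub>2 R\<^sub>2) u"
      "\<And>x. x \<in> closure (ball O\<^sub>1 R\<^sub>1 \<inter> ball O\<^sub>2 R\<^sub>2) \<Longrightarrow> u x = 0"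
  shows "u \<in> admissible O\<^sub>1 R\<^sub>1 O\<^sub>2 R\<^sub>2"
proof -
  have "open (ball O\<^sub>1 R\<^sub>1 \<union> ball O\<^sub>2 R\<^sub>2)" "bounded (ball O\<^sub>1 R\<^sub>1 \<union> ball O\<^sub>2 R\<^sub>2)"
    by auto
  from W0_1_inf_limit[OF this \<psi> bound lim]
  have "u \<in> W0_1_inf (ball O\<^sub>1 R\<^sub>1 \<union> ball O\<^sub>2 R\<^sub>2)"
    "has_weak_gradient (ball O\<^sub>1 R\<^sub>1 \<union> ball O\<^sub>2 R\<^sub>2) u g" "Linf_norm (ball O\<^sub>1 R\<^sub>1 \<union> ball O\<^sub>2 R\<^sub>2) g \<le> 1"
    by blast+
  then show ?thesis
    using u continuous_on_subset[OF u(1) subset_UNIV] unfolding admissible_def Let_def by blast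
qed

lemma
  fixes w :: "'a::euclidean_space \<Rightarrow> real"
  assumes "w \<in> admissible O\<^sub>1 R\<^sub>1 O\<^sub>2 R\<^sub>2"
  defines "U \<equiv> ball O\<^sub>1 R\<^sub>1 \<union> ball O\<^sub>2 R\<^sub>2"
  shows admissible_integrable: "integrable (lebesgue_on U) w"
    and admissible_radial: "radially_symmetric_on O\<^sub>1 (ball O\<^sub>1 R\<^sub>1) w"
      "radially_symmetric_on O\<^sub>2 (ball O\<^sub>2 R\<^sub>2) w"
    and admissible_vanishes: "x \<in> closure (ball O\<^sub>1 R\<^sub>1 \<inter> ball O\<^sub>2 R\<^sub>2) \<Longrightarrow> w x = 0"
    and admissible_lipschitz: "x \<in> U \<or> x \<notin> closure U \<Longrightarrow> p \<in> U \<or> p \<notin> closure U \<Longrightarrow>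
      \<bar>(if x \<in> U then w x else 0) - (if p \<in> U then w p else 0)\<bar> \<le> norm (x - p)"
proof -
  obtain g where w: "w \<in> W0_1_inf U" "continuous_on (closure U) w"
    and g: "has_weak_gradient U w g" "Linf_norm U g \<le> 1"
    and rad: "radially_symmetric_on O\<^sub>1 (ball O\<^sub>1 R\<^sub>1) w" "radially_symmetric_on O\<^sub>2 (ball O\<^sub>2 R\<^sub>2) w"
    and zero: "\<forall>x\<in>closure (ball O\<^sub>1 R\<^sub>1 \<inter> ball O\<^sub>2 R\<^sub>2). w x = 0"
    using assms(1) unfolding admissible_def Let_def U_def by blast
  have w0: "w \<in> W0_1_1 U"
    using w(1) by (simp add: W0_1_inf_def)
  then show "integrable (lebesgue_on U) w"
    by (simp add: W0_1_1_def)
  show "radially_symmetric_on O\<^sub>1 (ball O\<^sub>1 R\<^sub>1) w" "radially_symmetric_on O\<^sub>2 (ball O\<^sub>2 R\<^sub>2) w"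
    "x \<in> closure (ball O\<^sub>1 R\<^sub>1 \<inter> ball O\<^sub>2 R\<^sub>2) \<Longrightarrow> w x = 0"
    using rad zero by blast+
  have "AE x in lebesgue_on U. ennreal (norm (g x)) \<le> 1"
    by (rule eventually_mono[OF esssup_AE]) (rule order_trans[OF _ g(2)[unfolded Linf_norm_def]])
  then have AE: "AE x in lebesgue_on U. norm (g x) \<le> 1"
    by (simp add: ennreal_le_1)
  have U: "open U" "has_cutoffs U"
    unfolding U_def by (auto intro: has_cutoffs_Un has_cutoffs_ball)
  have cont: "continuous_on U w"
    by (rule continuous_on_subset[OF w(2) closure_subset])
  note lip = W0_zero_extension_lipschitz[OF U w0 cont g(1) AE]
  show "\<bar>(if x \<in> U then w x else 0) - (if p \<in> U then w p else 0)\<bar> \<le> norm (x - p)"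
    if "x \<in> U \<or> x \<notin> closure U" "p \<in> U \<or> p \<notin> closure U"
    using lip[OF that] lip[OF that(2,1)] unfolding abs_le_iff norm_minus_commute[of p x] by simp
qed

text \<open>The Lipschitz estimate is applied to points beyond the sphere, which must lie outside the closure of
the union. Radial symmetry allows \<open>x\<close> to be rotated onto the ray in a direction \<open>e\<close> where this is the
case; the direction through \<open>x\<close> itself may lead into the other ball if the two balls touch.\<close>

lemma admissible_le_dist_sphere:
  fixes w :: "'a::euclidean_space \<Rightarrow> real"
  assumes w: "w \<in> admissible O\<^sub>1 R\<^sub>1 O\<^sub>2 R\<^sub>2" and rad: "radially_symmetric_on c (ball c R) w"
    and sub: "ball c R \<subseteq> ball O\<^sub>1 R\<^sub>1 \<union> ball O\<^sub>2 R\<^sub>2"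
    and e: "norm e = 1" "\<And>d. d > 0 \<Longrightarrow> c + (R + d) *\<^sub>R e \<notin> closure (ball O\<^sub>1 R\<^sub>1 \<union> ball O\<^sub>2 R\<^sub>2)"
    and x: "x \<in> ball c R"
  shows "\<bar>w x\<bar> \<le> R - norm (x - c)"
proof -
  let ?U = "ball O\<^sub>1 R\<^sub>1 \<union> ball O\<^sub>2 R\<^sub>2"
  define r where "r = norm (x - c)"
  define y where "y = c + r *\<^sub>R e"
  have r: "0 \<le> r" "r < R"
    using x by (simp_all add: r_def dist_norm norm_minus_commute)
  have dist: "dist c y = r" "dist c x = r"
    using e(1) r by (simp_all add: y_def r_def dist_norm norm_minus_commute)
  then have y: "y \<in> ball c R"
    using r by simp
  have "w x = w y"
    using rad x y dist unfolding radially_symmetric_on_def by metis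
  moreover have "\<bar>w y\<bar> \<le> R + d - r" if "d > 0" for d
  proof -
    define p where "p = c + (R + d) *\<^sub>R e"
    have p: "p \<notin> closure ?U"
      using e(2)[OF that] by (simp add: p_def)
    then have "p \<notin> ?U"
      using closure_subset by blast
    have "y \<in> ?U"
      using y sub by blast
    have "y - p = (r - (R + d)) *\<^sub>R e"
      by (simp add: y_def p_def algebra_simps)
    then have "norm (y - p) = R + d - r"
      using e(1) r that by simp
    then show ?thesis
      using admissible_lipschitz[OF w disjI1[OF \<open>y \<in> ?U\<close>] disjI2[OF p]] \<open>y \<in> ?U\<close> \<open>p \<notin> ?U\<close>
      by (simp only: if_True if_False diff_0_right)
  qed
  ultimately show ?thesis
    using field_le_epsilon[of "\<bar>w x\<bar>" "R - r"] by (simp add: r_def algebra_simps)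
qed

text \<open>Continuity of the densities up to the boundary makes them bounded, so that both integrals exist and
pointwise comparison is enough.\<close>

lemma kantorovich_mono:
  fixes f\<^sub>p f\<^sub>m :: "'a::euclidean_space \<Rightarrow> real"
  assumes cont: "continuous_on (closure (ball O\<^sub>1 R\<^sub>1)) f\<^sub>p" "continuous_on (closure (ball O\<^sub>2 R\<^sub>2)) f\<^sub>m"
    and w: "w \<in> admissible O\<^sub>1 R\<^sub>1 O\<^sub>2 R\<^sub>2" and u: "u \<in> admissible O\<^sub>1 R\<^sub>1 O\<^sub>2 R\<^sub>2"
    and le: "\<And>x. x \<in> ball O\<^sub>1 R\<^sub>1 \<union> ball O\<^sub>2 R\<^sub>2 \<Longrightarrow>
      w x * (zero_ext (ball O\<^sub>1 R\<^sub>1) f\<^sub>p x - zero_ext (ball O\<^sub>2 R\<^sub>2) f\<^sub>m x)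
      \<le> u x * (zero_ext (ball O\<^sub>1 R\<^sub>1) f\<^sub>p x - zero_ext (ball O\<^sub>2 R\<^sub>2) f\<^sub>m x)"
  shows "kantorovich (ball O\<^sub>1 R\<^sub>1) (ball O\<^sub>2 R\<^sub>2) f\<^sub>p f\<^sub>m w
    \<le> kantorovich (ball O\<^sub>1 R\<^sub>1) (ball O\<^sub>2 R\<^sub>2) f\<^sub>p f\<^sub>m u"
proof -
  have bounded: "\<exists>C. \<forall>x. \<bar>zero_ext (ball c R) h x\<bar> \<le> C"
    if h: "continuous_on (closure (ball c R)) h" for c :: 'a and R and h :: "'a \<Rightarrow> real"
  proof -
    have "bounded (h ` closure (ball c R))"
      by (intro compact_imp_bounded compact_continuous_image[OF h])
        (simp add: compact_closure)
    then obtain C where "C > 0" and C: "\<And>x. x \<in> closure (ball c R) \<Longrightarrow> \<bar>h x\<bar> \<le> C"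
      by (auto simp: bounded_pos)
    have "\<bar>zero_ext (ball c R) h x\<bar> \<le> C" for x
      using C[OF subsetD[OF closure_subset], of x] \<open>C > 0\<close> by (simp add: zero_ext_def)
    then show ?thesis by blast
  qed
  have meas_ext: "zero_ext (ball c R) h \<in> borel_measurable (lebesgue_on S)"
    if h: "continuous_on (closure (ball c R)) h" for c :: 'a and R and h :: "'a \<Rightarrow> real" and S
  proof -
    have "h \<in> borel_measurable (lebesgue_on (ball c R))"
      by (intro continuous_imp_measurable_on_sets_lebesgue continuous_on_subset[OF h closure_subset]) simp
    then have "(\<lambda>x. if x \<in> ball c R then h x else 0) \<in> borel_measurable lebesgue"
      by (rule borel_measurable_if_I) simp
    then show ?thesis
      unfolding zero_ext_def[abs_def] by (rule measurable_restrict_space1)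
  qed
  let ?M = "lebesgue_on (ball O\<^sub>1 R\<^sub>1 \<union> ball O\<^sub>2 R\<^sub>2)"
  let ?f = "\<lambda>x. zero_ext (ball O\<^sub>1 R\<^sub>1) f\<^sub>p x - zero_ext (ball O\<^sub>2 R\<^sub>2) f\<^sub>m x"
  obtain C D where C: "\<And>x. \<bar>zero_ext (ball O\<^sub>1 R\<^sub>1) f\<^sub>p x\<bar> \<le> C" and D: "\<And>x. \<bar>zero_ext (ball O\<^sub>2 R\<^sub>2) f\<^sub>m x\<bar> \<le> D"
    using bounded[OF cont(1)] bounded[OF cont(2)] by blast
  have CD: "\<bar>?f x\<bar> \<le> C + D" for x
    using C[of x] D[of x] by linarith
  have meas: "?f \<in> borel_measurable ?M"
    by (intro borel_measurable_diff meas_ext cont)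
  have "(LINT x|?M. w x * ?f x) \<le> (LINT x|?M. u x * ?f x)"
    by (intro integral_mono integrable_mult_bounded[OF _ meas CD] admissible_integrable w u)
      (use le in simp)
  then show ?thesis
    by (simp add: kantorovich_def)
qed

section \<open>Disjoint balls\<close>

lemma closure_Un_balls_subset: "closure (ball a r \<union> ball b s) \<subseteq> cball a r \<union> cball b s"
  by (rule closure_minimal) auto

lemma disjoint_balls_centre: "ball a r \<inter> ball b s = {} \<Longrightarrow> r > 0 \<Longrightarrow> s \<le> dist a b"
  by (metis IntI centre_in_ball dist_commute emptyE mem_ball not_le)

text \<open>The ray leaving \<open>c\<close> away from the other centre never meets the other ball. One statement
serves both balls, with \<open>(c, R)\<close> either of the two.\<close>

lemma admissible_le_dist_sphere_disjoint:
  fixes w :: "'a::euclidean_space \<Rightarrow> real"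
  assumes w: "w \<in> admissible O\<^sub>1 R\<^sub>1 O\<^sub>2 R\<^sub>2"
    and sets: "ball c R \<union> ball c' R' = ball O\<^sub>1 R\<^sub>1 \<union> ball O\<^sub>2 R\<^sub>2"
    and rad: "radially_symmetric_on c (ball c R) w"
    and disj: "ball c R \<inter> ball c' R' = {}" and R: "R > 0" "R' > 0" and x: "x \<in> ball c R"
  shows "\<bar>w x\<bar> \<le> R - norm (x - c)"
proof (rule admissible_le_dist_sphere[OF w rad _ _ _ x])
  show "ball c R \<subseteq> ball O\<^sub>1 R\<^sub>1 \<union> ball O\<^sub>2 R\<^sub>2"
    using sets by blast
  have dist: "R' \<le> norm (c - c')"
    using disjoint_balls_centre[OF disj R(1)] by (simp add: dist_norm)
  define e where "e = sgn (c - c')"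
  have ne: "c - c' \<noteq> 0"
    using dist R(2) by auto
  then show "norm e = 1"
    by (simp add: e_def norm_sgn)
  show "c + (R + d) *\<^sub>R e \<notin> closure (ball O\<^sub>1 R\<^sub>1 \<union> ball O\<^sub>2 R\<^sub>2)" if "d > 0" for d
  proof -
    let ?p = "c + (R + d) *\<^sub>R e"
    have "norm (?p - c) = R + d"
      using R that \<open>norm e = 1\<close> by simp
    moreover have "norm (?p - c') = norm (c - c') + (R + d)"
    proof -
      have "?p - c' = (norm (c - c') + (R + d)) *\<^sub>R e"
        using ne by (simp add: e_def sgn_div_norm algebra_simps)
      then show ?thesis
        using R that \<open>norm e = 1\<close> by simp
    qed
    ultimately have "?p \<notin> cball c R \<union> cball c' R'"
      using dist R that by (simp add: dist_norm norm_minus_commute)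
    then show ?thesis
      using closure_Un_balls_subset[of c R c' R'] unfolding sets by blast
  qed
qed

lemma tent_difference_admissible:
  assumes R: "R\<^sub>1 > 0" "R\<^sub>2 > 0" and disj: "ball O\<^sub>1 R\<^sub>1 \<inter> ball O\<^sub>2 R\<^sub>2 = {}"
  shows "(\<lambda>x. tent O\<^sub>1 0 R\<^sub>1 x - tent O\<^sub>2 0 R\<^sub>2 x) \<in> admissible O\<^sub>1 R\<^sub>1 O\<^sub>2 R\<^sub>2"
proof (rule admissibleI)
  define \<psi> where "\<psi> k = soft_tent O\<^sub>1 0 R\<^sub>1 (1 / real (Suc k))" for k
  define \<phi> where "\<phi> k = soft_tent O\<^sub>2 0 R\<^sub>2 (1 / real (Suc k))" for k
  note e = reciprocal_null_sequence
  have \<psi>: "\<psi> k \<in> test_fun (ball O\<^sub>1 R\<^sub>1)" and \<phi>: "\<phi> k \<in> test_fun (ball O\<^sub>2 R\<^sub>2)" for k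
    using soft_tent_test_fun[OF e(1), of O\<^sub>1 0 R\<^sub>1 k] soft_tent_test_fun[OF e(1), of O\<^sub>2 0 R\<^sub>2 k]
    by (simp_all only: \<psi>_def \<phi>_def add_0)
  have grad: "grad (\<lambda>x. \<psi> k x - \<phi> k x) x = grad (\<psi> k) x - grad (\<phi> k) x" for k x
    by (rule grad_diff[OF test_fun_smooth[OF \<psi>] test_fun_smooth[OF \<phi>]])
  show "(\<lambda>x. \<psi> k x - \<phi> k x) \<in> test_fun (ball O\<^sub>1 R\<^sub>1 \<union> ball O\<^sub>2 R\<^sub>2)" for k
    using test_fun_add[OF test_fun_mono[OF \<psi>, of _ k] test_fun_cmult[OF test_fun_mono[OF \<phi>, of _ k], of _ "-1"],
        of "ball O\<^sub>1 R\<^sub>1 \<union> ball O\<^sub>2 R\<^sub>2"] by simp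
  show "\<bar>\<psi> k x - \<phi> k x\<bar> \<le> R\<^sub>1 + R\<^sub>2" for k x
    using soft_tent_bounds[OF e(1), of R\<^sub>1 O\<^sub>1 0 k x] soft_tent_bounds[OF e(1), of R\<^sub>2 O\<^sub>2 0 k x] R
    unfolding \<psi>_def \<phi>_def by linarith
  show "norm (grad (\<lambda>x. \<psi> k x - \<phi> k x) x) \<le> 1" for k x
  proof (cases "x \<in> ball O\<^sub>1 R\<^sub>1")
    case True
    then have "x \<notin> ball O\<^sub>2 R\<^sub>2"
      using disj by blast
    then show ?thesis
      using norm_grad_soft_tent[OF e(1), of O\<^sub>1 0 R\<^sub>1 k x, folded \<psi>_def]
      unfolding grad grad_test_fun_zero[OF \<phi> \<open>x \<notin> ball O\<^sub>2 R\<^sub>2\<close>] by simp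
  next
    case False
    then show ?thesis
      using norm_grad_soft_tent[OF e(1), of O\<^sub>2 0 R\<^sub>2 k x, folded \<phi>_def]
      unfolding grad grad_test_fun_zero[OF \<psi> False] by simp
  qed
  show "(\<lambda>k. \<psi> k x - \<phi> k x) \<longlonglongrightarrow> tent O\<^sub>1 0 R\<^sub>1 x - tent O\<^sub>2 0 R\<^sub>2 x" for x
    unfolding \<psi>_def \<phi>_def by (intro tendsto_diff soft_tent_tendsto e)
  show "(\<lambda>k. grad (\<lambda>x. \<psi> k x - \<phi> k x) x) \<longlonglongrightarrow> tent_grad O\<^sub>1 0 R\<^sub>1 x - tent_grad O\<^sub>2 0 R\<^sub>2 x" for x
    unfolding grad unfolding \<psi>_def \<phi>_def by (intro tendsto_diff grad_soft_tent_tendsto e)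
  show "continuous_on UNIV (\<lambda>x. tent O\<^sub>1 0 R\<^sub>1 x - tent O\<^sub>2 0 R\<^sub>2 x)"
    by (intro continuous_on_diff continuous_on_tent)
  have zero: "tent O\<^sub>2 0 R\<^sub>2 x = 0" if "x \<in> ball O\<^sub>1 R\<^sub>1" for x
    using that disj R by (intro tent_eq_0_outside) auto
  show "radially_symmetric_on O\<^sub>1 (ball O\<^sub>1 R\<^sub>1) (\<lambda>x. tent O\<^sub>1 0 R\<^sub>1 x - tent O\<^sub>2 0 R\<^sub>2 x)"
    unfolding radially_symmetric_on_def by (metis zero tent_radial)
  have zero: "tent O\<^sub>1 0 R\<^sub>1 x = 0" if "x \<in> ball O\<^sub>2 R\<^sub>2" for x
    using that disj R by (intro tent_eq_0_outside) auto
  show "radially_symmetric_on O\<^sub>2 (ball O\<^sub>2 R\<^sub>2) (\<lambda>x. tent O\<^sub>1 0 R\<^sub>1 x - tent O\<^sub>2 0 R\<^sub>2 x)"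
    unfolding radially_symmetric_on_def by (metis zero tent_radial)
qed (use disj in simp)

section \<open>Concentric balls\<close>

text \<open>The balls may come in either order, so the shell between them has middle radius \<open>(R\<^sub>1 + R\<^sub>2) / 2\<close> and
half-width \<open>\<bar>R\<^sub>1 - R\<^sub>2\<bar> / 2\<close>; its tent vanishes on the smaller ball.\<close>

lemma signed_tent_admissible:
  assumes R: "R\<^sub>1 > 0" "R\<^sub>2 > 0" and s: "\<bar>s\<bar> = 1"
  shows "(\<lambda>x. s * tent c ((R\<^sub>1 + R\<^sub>2) / 2) (\<bar>R\<^sub>1 - R\<^sub>2\<bar> / 2) x) \<in> admissible c R\<^sub>1 c R\<^sub>2"
proof (rule admissibleI)
  let ?m = "(R\<^sub>1 + R\<^sub>2) / 2" and ?a = "\<bar>R\<^sub>1 - R\<^sub>2\<bar> / 2"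
  have outer: "?m + ?a = max R\<^sub>1 R\<^sub>2" and inner: "?m - ?a = min R\<^sub>1 R\<^sub>2"
    by (simp_all add: max_def min_def abs_if field_simps)
  have U: "ball c R\<^sub>1 \<union> ball c R\<^sub>2 = ball c (max R\<^sub>1 R\<^sub>2)" and I: "ball c R\<^sub>1 \<inter> ball c R\<^sub>2 = ball c (min R\<^sub>1 R\<^sub>2)"
    by auto
  define \<psi> where "\<psi> k = soft_tent c ?m ?a (1 / real (Suc k))" for k
  note e = reciprocal_null_sequence
  have \<psi>: "\<psi> k \<in> test_fun (ball c R\<^sub>1 \<union> ball c R\<^sub>2)" for k
    using soft_tent_test_fun[OF e(1), of c ?m ?a k] unfolding \<psi>_def U outer .
  have grad: "grad (\<lambda>x. s * \<psi> k x) x = s *\<^sub>R grad (\<psi> k) x" for k x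
    by (rule grad_cmult[OF test_fun_smooth[OF \<psi>]])
  show "(\<lambda>x. s * \<psi> k x) \<in> test_fun (ball c R\<^sub>1 \<union> ball c R\<^sub>2)" for k
    by (rule test_fun_cmult[OF \<psi>])
  show "\<bar>s * \<psi> k x\<bar> \<le> ?a" for k x
    using soft_tent_bounds[OF e(1), of ?a c ?m k x] unfolding \<psi>_def abs_mult s by simp
  show "norm (grad (\<lambda>x. s * \<psi> k x) x) \<le> 1" for k x
    using norm_grad_soft_tent[OF e(1), of c ?m ?a k x, folded \<psi>_def] unfolding grad by (simp add: s)
  show "(\<lambda>k. s * \<psi> k x) \<longlonglongrightarrow> s * tent c ?m ?a x" for x
    unfolding \<psi>_def by (intro tendsto_mult_left soft_tent_tendsto e)
  show "(\<lambda>k. grad (\<lambda>x. s * \<psi> k x) x) \<longlonglongrightarrow> s *\<^sub>R tent_grad c ?m ?a x" for x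
    unfolding grad unfolding \<psi>_def by (intro tendsto_scaleR tendsto_const grad_soft_tent_tendsto e)
  show "continuous_on UNIV (\<lambda>x. s * tent c ?m ?a x)"
    by (intro continuous_on_mult continuous_on_const continuous_on_tent)
  show "radially_symmetric_on c (ball c R\<^sub>1) (\<lambda>x. s * tent c ?m ?a x)"
    "radially_symmetric_on c (ball c R\<^sub>2) (\<lambda>x. s * tent c ?m ?a x)"
    unfolding radially_symmetric_on_def by (metis tent_radial)+
  show "s * tent c ?m ?a x = 0" if "x \<in> closure (ball c R\<^sub>1 \<inter> ball c R\<^sub>2)" for x
  proof -
    have "x \<in> cball c (min R\<^sub>1 R\<^sub>2)"
      using that R unfolding I by (subst (asm) closure_ball) auto
    then have "norm (x - c) \<le> ?m - ?a"
      unfolding inner by (simp add: dist_norm norm_minus_commute)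
    then have "?a - \<bar>norm (x - c) - ?m\<bar> \<le> 0"
      using abs_ge_minus_self[of "norm (x - c) - ?m"] by simp
    then show ?thesis
      by (simp add: tent_def max_def)
  qed
qed

text \<open>In the shell, \<open>w\<close> is compared with its zero values beyond the outer sphere and, along the radius
through \<open>x\<close>, on the closed inner ball.\<close>

lemma admissible_concentric_le_tent:
  fixes w :: "'a::euclidean_space \<Rightarrow> real"
  assumes w: "w \<in> admissible c R\<^sub>1 c R\<^sub>2" and R: "R\<^sub>1 > 0" "R\<^sub>2 > 0" "R\<^sub>1 \<noteq> R\<^sub>2"
    and x: "x \<in> ball c R\<^sub>1 \<union> ball c R\<^sub>2"
  shows "\<bar>w x\<bar> \<le> tent c ((R\<^sub>1 + R\<^sub>2) / 2) (\<bar>R\<^sub>1 - R\<^sub>2\<bar> / 2) x"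
proof -
  let ?a = "min R\<^sub>1 R\<^sub>2" and ?b = "max R\<^sub>1 R\<^sub>2" and ?r = "norm (x - c)"
  have U: "ball c R\<^sub>1 \<union> ball c R\<^sub>2 = ball c ?b" and "ball c R\<^sub>1 \<inter> ball c R\<^sub>2 = ball c ?a"
    by auto
  then have I: "closure (ball c R\<^sub>1 \<inter> ball c R\<^sub>2) = cball c ?a"
    using R closure_ball[of ?a c] by simp
  have ab: "0 < ?a" "?a < ?b" "0 < ?b"
    using R by auto
  show ?thesis
  proof (cases "?r \<le> ?a")
    case True
    then have "w x = 0"
      by (intro admissible_vanishes[OF w]) (simp add: I dist_norm norm_minus_commute)
    then show ?thesis
      by (simp add: tent_nonneg)
  next
    case False
    obtain e :: 'a where e: "norm e = 1"
      using vector_choose_size[of 1] by auto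
    have "radially_symmetric_on c (ball c ?b) w"
      using admissible_radial[OF w] by (simp add: max_def)
    then have outer: "\<bar>w x\<bar> \<le> ?b - ?r"
    proof (rule admissible_le_dist_sphere[OF w _ _ e])
      show "ball c ?b \<subseteq> ball c R\<^sub>1 \<union> ball c R\<^sub>2" "x \<in> ball c ?b"
        using x unfolding U by auto
      show "c + (?b + d) *\<^sub>R e \<notin> closure (ball c R\<^sub>1 \<union> ball c R\<^sub>2)" if "d > 0" for d
        using that ab e closure_ball[of ?b c] unfolding U by (simp add: dist_norm)
    qed
    define p where "p = c + (?a / ?r) *\<^sub>R (x - c)"
    have r: "?r > 0"
      using False ab by linarith
    have "norm (p - c) = ?a"
      using r ab by (simp add: p_def)
    then have "dist c p = ?a"
      by (simp add: dist_norm norm_minus_commute)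
    then have "p \<in> ball c ?b" "p \<in> cball c ?a"
      using ab by simp_all
    then have p: "p \<in> ball c R\<^sub>1 \<union> ball c R\<^sub>2" "w p = 0"
      unfolding U using admissible_vanishes[OF w, of p] I by blast+
    have "x - p = (1 - ?a / ?r) *\<^sub>R (x - c)"
      by (simp add: p_def algebra_simps)
    moreover have "0 \<le> 1 - ?a / ?r"
      using False divide_le_eq_1_pos[OF r, of ?a] by linarith
    ultimately have "norm (x - p) = (1 - ?a / ?r) * ?r"
      by simp
    also have "\<dots> = ?r - ?a"
      using r by (simp add: left_diff_distrib)
    finally have "\<bar>w x\<bar> \<le> ?r - ?a"
      using admissible_lipschitz[OF w disjI1[OF x] disjI1[OF p(1)]] x p by simp
    with outer show ?thesis
      unfolding tent_def by (auto simp: max_def min_def abs_if field_simps split: if_splits)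
  qed
qed

section \<open>Existence of a maximiser\<close>

theorem theorem1p2:
  fixes O\<^sub>1 O\<^sub>2 :: "real ^ 'n" and R\<^sub>1 R\<^sub>2 :: real
    and \<Omega> \<Omega>' :: "(real ^ 'n) set"
    and f\<^sub>p f\<^sub>m :: "real ^ 'n \<Rightarrow> real"
  assumes radii: "R\<^sub>1 > 0" "R\<^sub>2 > 0"
    and balls: "\<Omega> = ball O\<^sub>1 R\<^sub>1" "\<Omega>' = ball O\<^sub>2 R\<^sub>2"
    and configuration: "\<Omega> \<inter> \<Omega>' = {} \<or> (O\<^sub>2 = O\<^sub>1 \<and> R\<^sub>1 \<noteq> R\<^sub>2)"
    and cont: "continuous_on (closure \<Omega>) f\<^sub>p" "continuous_on (closure \<Omega>') f\<^sub>m"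
    and pos: "\<forall>x\<in>\<Omega>. f\<^sub>p x > 0" "\<forall>x\<in>\<Omega>'. f\<^sub>m x > 0"
    and balance: "(LINT x|lebesgue_on \<Omega>. f\<^sub>p x) = 1" "(LINT x|lebesgue_on \<Omega>'. f\<^sub>m x) = 1"
  shows "\<exists>u\<in>admissible O\<^sub>1 R\<^sub>1 O\<^sub>2 R\<^sub>2. \<forall>w\<in>admissible O\<^sub>1 R\<^sub>1 O\<^sub>2 R\<^sub>2.
           kantorovich \<Omega> \<Omega>' f\<^sub>p f\<^sub>m w \<le> kantorovich \<Omega> \<Omega>' f\<^sub>p f\<^sub>m u"
  using configuration
proof
  assume disj: "\<Omega> \<inter> \<Omega>' = {}"
  \<comment> \<open>The cone over each ball, with the sign of \<open>f\<close> there.\<close>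
  let ?u = "\<lambda>x. tent O\<^sub>1 0 R\<^sub>1 x - tent O\<^sub>2 0 R\<^sub>2 x"
  have u: "?u \<in> admissible O\<^sub>1 R\<^sub>1 O\<^sub>2 R\<^sub>2"
    by (rule tent_difference_admissible[OF radii disj[unfolded balls]])
  have "kantorovich \<Omega> \<Omega>' f\<^sub>p f\<^sub>m w \<le> kantorovich \<Omega> \<Omega>' f\<^sub>p f\<^sub>m ?u"
    if w: "w \<in> admissible O\<^sub>1 R\<^sub>1 O\<^sub>2 R\<^sub>2" for w
    unfolding balls
  proof (rule kantorovich_mono[OF cont[unfolded balls] w u], fold balls)
    fix x assume "x \<in> \<Omega> \<union> \<Omega>'"
    then show "w x * (zero_ext \<Omega> f\<^sub>p x - zero_ext \<Omega>' f\<^sub>m x) \<le> ?u x * (zero_ext \<Omega> f\<^sub>p x - zero_ext \<Omega>' f\<^sub>m x)"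
    proof
      assume x: "x \<in> \<Omega>"
      then have x': "x \<notin> \<Omega>'"
        using disj by blast
      have "\<bar>w x\<bar> \<le> R\<^sub>1 - norm (x - O\<^sub>1)"
        using admissible_le_dist_sphere_disjoint[OF w refl admissible_radial(1)[OF w]] disj radii x
        unfolding balls by blast
      moreover have "tent O\<^sub>2 0 R\<^sub>2 x = 0"
        using x' radii(2) by (intro tent_eq_0_outside) (simp_all add: balls)
      ultimately have "w x \<le> ?u x"
        by (simp add: tent_def)
      then show ?thesis
        using x x' pos(1) by (simp add: zero_ext_def mult_right_mono)
    next
      assume x: "x \<in> \<Omega>'"
      then have x': "x \<notin> \<Omega>"
        using disj by blast
      have "\<bar>w x\<bar> \<le> R\<^sub>2 - norm (x - O\<^sub>2)"
        using admissible_le_dist_sphere_disjoint[OF w Un_commute admissible_radial(2)[OF w]] disj radii x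
        unfolding balls by blast
      moreover have "tent O\<^sub>1 0 R\<^sub>1 x = 0"
        using x' radii(1) by (intro tent_eq_0_outside) (simp_all add: balls)
      ultimately have "?u x \<le> w x"
        by (simp add: tent_def)
      then show ?thesis
        using x x' pos(2) by (simp add: zero_ext_def mult_right_mono)
    qed
  qed
  with u show ?thesis by blast
next
  assume "O\<^sub>2 = O\<^sub>1 \<and> R\<^sub>1 \<noteq> R\<^sub>2"
  then have O2: "O\<^sub>2 = O\<^sub>1" and ne: "R\<^sub>1 \<noteq> R\<^sub>2" by auto
  let ?T = "tent O\<^sub>1 ((R\<^sub>1 + R\<^sub>2) / 2) (\<bar>R\<^sub>1 - R\<^sub>2\<bar> / 2)"
  \<comment> \<open>On the shell \<open>f\<close> is \<open>f\<^sub>p\<close> if \<open>\<Omega>\<close> is the larger ball, and \<open>- f\<^sub>m\<close> otherwise.\<close>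
  let ?u = "\<lambda>x. sgn (R\<^sub>1 - R\<^sub>2) * ?T x"
  have u: "?u \<in> admissible O\<^sub>1 R\<^sub>1 O\<^sub>2 R\<^sub>2"
    unfolding O2 using ne by (intro signed_tent_admissible radii) (simp add: sgn_if)
  have "kantorovich \<Omega> \<Omega>' f\<^sub>p f\<^sub>m w \<le> kantorovich \<Omega> \<Omega>' f\<^sub>p f\<^sub>m ?u"
    if w: "w \<in> admissible O\<^sub>1 R\<^sub>1 O\<^sub>2 R\<^sub>2" for w
    unfolding balls
  proof (rule kantorovich_mono[OF cont[unfolded balls] w u], fold balls)
    fix x assume x: "x \<in> \<Omega> \<union> \<Omega>'"
    have bound: "\<bar>w x\<bar> \<le> ?T x"
      using admissible_concentric_le_tent[OF w[unfolded O2] radii ne] x unfolding balls O2 by blast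
    show "w x * (zero_ext \<Omega> f\<^sub>p x - zero_ext \<Omega>' f\<^sub>m x) \<le> ?u x * (zero_ext \<Omega> f\<^sub>p x - zero_ext \<Omega>' f\<^sub>m x)"
    proof (cases "x \<in> \<Omega> \<inter> \<Omega>'")
      case True
      then have "x \<in> closure (ball O\<^sub>1 R\<^sub>1 \<inter> ball O\<^sub>2 R\<^sub>2)"
        unfolding balls by (rule subsetD[OF closure_subset])
      then have "w x = 0" "?u x = 0"
        by (rule admissible_vanishes[OF w], rule admissible_vanishes[OF u])
      then show ?thesis
        by (simp only:)
    next
      case False
      show ?thesis
      proof (cases "x \<in> \<Omega>")
        case True
        with False have x': "x \<notin> \<Omega>'" by blast
        then have "R\<^sub>2 < R\<^sub>1"
          using True unfolding balls O2 by simp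
        then have "w x \<le> ?u x"
          using bound by simp
        then show ?thesis
          using True x' pos(1) by (simp add: zero_ext_def mult_right_mono)
      next
        case False
        with x have x': "x \<in> \<Omega>'" by blast
        then have "R\<^sub>1 < R\<^sub>2"
          using False unfolding balls O2 by simp
        then have "?u x \<le> w x"
          using bound by simp
        then show ?thesis
          using False x' pos(2) by (simp add: zero_ext_def mult_right_mono)
      qed
    qed
  qed
  with u show ?thesis by blast
qed

end
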